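(* Let $\Lambda$ be a ring (not necessarily commutative) and let $M$ be a finitely generated left $\Lambda$-module. Assume that at least one of the following conditions is satisfied: (1) $\Lambda$ is a left Noetherian ring; (2) $\Lambda$ is a semi-local ring, that is, $\Lambda/\mathrm{J}(\Lambda)$ is a semi-simple ring, where $\mathrm{J}(\Lambda)$ denotes the Jacobson radical of $\Lambda$; (3) $\Lambda$ is a module-finite algebra over a commutative ring $R$. Then $M$ is a reflexive $\Lambda$-module, that is, the canonical map $h_M : M \to M^{**}$ is an isomorphism, if and only if there exists at least one isomorphism $M \cong M^{**}$ of left $\Lambda$-modules.
   Context: Rings are associative with identity and modules are unital. For a left $\Lambda$-module $X$, $X^* = \operatorname{Hom}_\Lambda(X,\Lambda)$ denotes the $\Lambda$-dual of $X$, which is a right $\Lambda$-module via $(f\lambda)(x) = f(x)\lambda$. Likewise, for a right $\Lambda$-module $N$, $N^* = \operatorname{Hom}_\Lambda(N,\Lambda)$ (homomorphisms of right $\Lambda$-modules) is a left $\Lambda$-module via $(\lambda g)(n) = \lambda g(n)$. Thus for a left $\Lambda$-module $M$, the bidual $M^{**} = (M^* )^*$ is a left $\Lambda$-module. The canonical map $h_M : M \to M^{**}$ is the evaluation homomorphism $h_M(m)(f) = f(m)$ for $m \in M$, $f \in M^*$. The module $M$ is called reflexive if $h_M$ is an isomorphism. A module-finite algebra over a commutative ring $R$ is a ring $\Lambda$ with a ring homomorphism from $R$ to the center of $\Lambda$ making $\Lambda$ a finitely generated $R$-module. *)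

theory Defs
  imports "HOL-Algebra.Module" "HOL-Algebra.QuotRing"
begin

section \<open>Modules over a not necessarily commutative ring\<close>

text \<open>
  The locale \<^locale>\<open>module\<close> of HOL-Algebra is restricted to commutative rings.
  Its records are reused here for left and for right modules. In a right module
  the field \<^const>\<open>smult\<close> still takes the scalar first, so that
  \<open>a \<odot>\<^bsub>N\<^esub> x\<close> stands for the product of \<open>x\<close> by \<open>a\<close> on the right; sidedness shows
  up in the associativity law only. The fields \<^const>\<open>mult\<close> and \<^const>\<open>one\<close> of a
  module record play no role.
\<close>

locale left_module = R?: ring R + M?: abelian_group M
    for R :: "('a, 'b) ring_scheme" (structure) and M :: "('a, 'm, 'c) module_scheme" (structure) +
  assumes smult_closed [simp, intro]:
      "\<lbrakk> a \<in> carrier R; x \<in> carrier M \<rbrakk> \<Longrightarrow> a \<odot>\<^bsub>M\<^esub> x \<in> carrier M"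
    and smult_l_distr:
      "\<lbrakk> a \<in> carrier R; b \<in> carrier R; x \<in> carrier M \<rbrakk> \<Longrightarrow>
        (a \<oplus> b) \<odot>\<^bsub>M\<^esub> x = a \<odot>\<^bsub>M\<^esub> x \<oplus>\<^bsub>M\<^esub> b \<odot>\<^bsub>M\<^esub> x"
    and smult_r_distr:
      "\<lbrakk> a \<in> carrier R; x \<in> carrier M; y \<in> carrier M \<rbrakk> \<Longrightarrow>
        a \<odot>\<^bsub>M\<^esub> (x \<oplus>\<^bsub>M\<^esub> y) = a \<odot>\<^bsub>M\<^esub> x \<oplus>\<^bsub>M\<^esub> a \<odot>\<^bsub>M\<^esub> y"
    and smult_assoc:
      "\<lbrakk> a \<in> carrier R; b \<in> carrier R; x \<in> carrier M \<rbrakk> \<Longrightarrow>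
        (a \<otimes> b) \<odot>\<^bsub>M\<^esub> x = a \<odot>\<^bsub>M\<^esub> (b \<odot>\<^bsub>M\<^esub> x)"
    and smult_one [simp]:
      "x \<in> carrier M \<Longrightarrow> \<one> \<odot>\<^bsub>M\<^esub> x = x"

locale right_module = R?: ring R + M?: abelian_group M
    for R :: "('a, 'b) ring_scheme" (structure) and M :: "('a, 'm, 'c) module_scheme" (structure) +
  assumes smult_closed [simp, intro]:
      "\<lbrakk> a \<in> carrier R; x \<in> carrier M \<rbrakk> \<Longrightarrow> a \<odot>\<^bsub>M\<^esub> x \<in> carrier M"
    and smult_l_distr:
      "\<lbrakk> a \<in> carrier R; b \<in> carrier R; x \<in> carrier M \<rbrakk> \<Longrightarrow>
        (a \<oplus> b) \<odot>\<^bsub>M\<^esub> x = a \<odot>\<^bsub>M\<^esub> x \<oplus>\<^bsub>M\<^esub> b \<odot>\<^bsub>M\<^esub> x"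
    and smult_r_distr:
      "\<lbrakk> a \<in> carrier R; x \<in> carrier M; y \<in> carrier M \<rbrakk> \<Longrightarrow>
        a \<odot>\<^bsub>M\<^esub> (x \<oplus>\<^bsub>M\<^esub> y) = a \<odot>\<^bsub>M\<^esub> x \<oplus>\<^bsub>M\<^esub> a \<odot>\<^bsub>M\<^esub> y"
    and smult_assoc:
      "\<lbrakk> a \<in> carrier R; b \<in> carrier R; x \<in> carrier M \<rbrakk> \<Longrightarrow>
        (a \<otimes> b) \<odot>\<^bsub>M\<^esub> x = b \<odot>\<^bsub>M\<^esub> (a \<odot>\<^bsub>M\<^esub> x)"
    and smult_one [simp]:
      "x \<in> carrier M \<Longrightarrow> \<one> \<odot>\<^bsub>M\<^esub> x = x"

definition left_regular :: "('a, 'b) ring_scheme \<Rightarrow> ('a, 'a) module"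
  where "left_regular R =
    \<lparr>carrier = carrier R, mult = mult R, one = one R, zero = zero R, add = add R,
     smult = (\<lambda>a x. a \<otimes>\<^bsub>R\<^esub> x)\<rparr>"

definition right_regular :: "('a, 'b) ring_scheme \<Rightarrow> ('a, 'a) module"
  where "right_regular R =
    \<lparr>carrier = carrier R, mult = mult R, one = one R, zero = zero R, add = add R,
     smult = (\<lambda>a x. x \<otimes>\<^bsub>R\<^esub> a)\<rparr>"

text \<open>
  Because of the convention on \<^const>\<open>smult\<close>, the following serves for homomorphisms
  between two left modules as well as between two right modules.
\<close>

definition module_hom ::
    "('a, 'b) ring_scheme \<Rightarrow> ('a, 'm, 'c) module_scheme \<Rightarrow> ('a, 'n, 'd) module_scheme
      \<Rightarrow> ('m \<Rightarrow> 'n) set"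
  where "module_hom R M N =
    {f \<in> carrier M \<rightarrow> carrier N.
      (\<forall>x\<in>carrier M. \<forall>y\<in>carrier M. f (x \<oplus>\<^bsub>M\<^esub> y) = f x \<oplus>\<^bsub>N\<^esub> f y) \<and>
      (\<forall>a\<in>carrier R. \<forall>x\<in>carrier M. f (a \<odot>\<^bsub>M\<^esub> x) = a \<odot>\<^bsub>N\<^esub> f x)}"

definition module_iso ::
    "('a, 'b) ring_scheme \<Rightarrow> ('a, 'm, 'c) module_scheme \<Rightarrow> ('a, 'n, 'd) module_scheme
      \<Rightarrow> ('m \<Rightarrow> 'n) set"
  where "module_iso R M N =
    {f \<in> module_hom R M N. bij_betw f (carrier M) (carrier N)}"


section \<open>Duals and reflexivity\<close>

text \<open>
  Elements of a dual are taken extensional, so that homomorphisms agreeing on the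
  carrier are equal. The dual of a left module is a right module and vice versa.
\<close>

definition left_dual ::
    "('a, 'b) ring_scheme \<Rightarrow> ('a, 'm, 'c) module_scheme \<Rightarrow> ('a, 'm \<Rightarrow> 'a) module"
  where "left_dual R M =
    \<lparr>carrier = module_hom R M (left_regular R) \<inter> extensional (carrier M),
     mult = undefined, one = undefined,
     zero = (\<lambda>x\<in>carrier M. \<zero>\<^bsub>R\<^esub>),
     add = (\<lambda>f g. \<lambda>x\<in>carrier M. f x \<oplus>\<^bsub>R\<^esub> g x),
     smult = (\<lambda>a f. \<lambda>x\<in>carrier M. f x \<otimes>\<^bsub>R\<^esub> a)\<rparr>"

definition right_dual ::
    "('a, 'b) ring_scheme \<Rightarrow> ('a, 'm, 'c) module_scheme \<Rightarrow> ('a, 'm \<Rightarrow> 'a) module"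
  where "right_dual R N =
    \<lparr>carrier = module_hom R N (right_regular R) \<inter> extensional (carrier N),
     mult = undefined, one = undefined,
     zero = (\<lambda>x\<in>carrier N. \<zero>\<^bsub>R\<^esub>),
     add = (\<lambda>f g. \<lambda>x\<in>carrier N. f x \<oplus>\<^bsub>R\<^esub> g x),
     smult = (\<lambda>a f. \<lambda>x\<in>carrier N. a \<otimes>\<^bsub>R\<^esub> f x)\<rparr>"

definition bidual ::
    "('a, 'b) ring_scheme \<Rightarrow> ('a, 'm, 'c) module_scheme \<Rightarrow> ('a, ('m \<Rightarrow> 'a) \<Rightarrow> 'a) module"
  where "bidual R M = right_dual R (left_dual R M)"

definition canonical_map ::
    "('a, 'b) ring_scheme \<Rightarrow> ('a, 'm, 'c) module_scheme \<Rightarrow> 'm \<Rightarrow> ('m \<Rightarrow> 'a) \<Rightarrow> 'a"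
  where "canonical_map R M = (\<lambda>m\<in>carrier M. \<lambda>f\<in>carrier (left_dual R M). f m)"

definition reflexive_module ::
    "('a, 'b) ring_scheme \<Rightarrow> ('a, 'm, 'c) module_scheme \<Rightarrow> bool"
  where "reflexive_module R M \<longleftrightarrow> canonical_map R M \<in> module_iso R M (bidual R M)"


section \<open>Finiteness conditions\<close>

text \<open>
  The locale \<^locale>\<open>submodule\<close> of HOL-Algebra does not refer to commutativity of
  the ring of scalars.
\<close>

definition module_span ::
    "('a, 'b) ring_scheme \<Rightarrow> ('a, 'm, 'c) module_scheme \<Rightarrow> 'm set \<Rightarrow> 'm set"
  where "module_span R M A = \<Inter>{H. submodule H R M \<and> A \<subseteq> H}"

definition finitely_generated ::
    "('a, 'b) ring_scheme \<Rightarrow> ('a, 'm, 'c) module_scheme \<Rightarrow> bool"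
  where "finitely_generated R M \<longleftrightarrow>
    (\<exists>A. finite A \<and> A \<subseteq> carrier M \<and> module_span R M A = carrier M)"

abbreviation left_ideal :: "'a set \<Rightarrow> ('a, 'b) ring_scheme \<Rightarrow> bool"
  where "left_ideal I R \<equiv> submodule I R (left_regular R)"

definition left_noetherian_ring :: "('a, 'b) ring_scheme \<Rightarrow> bool"
  where "left_noetherian_ring R \<longleftrightarrow> ring R \<and>
    (\<forall>I :: nat \<Rightarrow> 'a set.
      (\<forall>n. left_ideal (I n) R \<and> I n \<subseteq> I (Suc n)) \<longrightarrow> (\<exists>k. \<forall>n\<ge>k. I n = I k))"

definition maximal_left_ideal :: "'a set \<Rightarrow> ('a, 'b) ring_scheme \<Rightarrow> bool"
  where "maximal_left_ideal I R \<longleftrightarrow> left_ideal I R \<and> I \<noteq> carrier R \<and>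
    (\<forall>K. left_ideal K R \<and> I \<subseteq> K \<longrightarrow> K = I \<or> K = carrier R)"

text \<open>For the zero ring, which has no maximal left ideals, this is the whole ring.\<close>

definition jacobson_radical :: "('a, 'b) ring_scheme \<Rightarrow> 'a set"
  where "jacobson_radical R = {x \<in> carrier R. \<forall>I. maximal_left_ideal I R \<longrightarrow> x \<in> I}"

text \<open>
  Following Lam, a module is semisimple if each of its submodules is a direct summand,
  and a ring is semisimple if it is so as a left module over itself.
\<close>

definition semisimple_module ::
    "('a, 'b) ring_scheme \<Rightarrow> ('a, 'm, 'c) module_scheme \<Rightarrow> bool"
  where "semisimple_module R M \<longleftrightarrow>
    (\<forall>H. submodule H R M \<longrightarrow>
      (\<exists>K. submodule K R M \<and> H \<inter> K = {\<zero>\<^bsub>M\<^esub>} \<and> H <+>\<^bsub>M\<^esub> K = carrier M))"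

definition semisimple_ring :: "('a, 'b) ring_scheme \<Rightarrow> bool"
  where "semisimple_ring R \<longleftrightarrow> ring R \<and> semisimple_module R (left_regular R)"

definition semilocal_ring :: "('a, 'b) ring_scheme \<Rightarrow> bool"
  where "semilocal_ring R \<longleftrightarrow> ring R \<and> semisimple_ring (R Quot (jacobson_radical R))"

definition ring_center :: "('a, 'b) ring_scheme \<Rightarrow> 'a set"
  where "ring_center R = {z \<in> carrier R. \<forall>x\<in>carrier R. z \<otimes>\<^bsub>R\<^esub> x = x \<otimes>\<^bsub>R\<^esub> z}"

definition scalar_module :: "('r \<Rightarrow> 'a) \<Rightarrow> ('a, 'b) ring_scheme \<Rightarrow> ('r, 'a) module"
  where "scalar_module \<phi> S =
    \<lparr>carrier = carrier S, mult = mult S, one = one S, zero = zero S, add = add S,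
     smult = (\<lambda>r x. \<phi> r \<otimes>\<^bsub>S\<^esub> x)\<rparr>"

definition module_finite_algebra ::
    "('r, 'd) ring_scheme \<Rightarrow> ('a, 'b) ring_scheme \<Rightarrow> ('r \<Rightarrow> 'a) \<Rightarrow> bool"
  where "module_finite_algebra R S \<phi> \<longleftrightarrow>
    cring R \<and> ring S \<and> \<phi> \<in> ring_hom R S \<and> \<phi> ` carrier R \<subseteq> ring_center S \<and>
    finitely_generated R (scalar_module \<phi> S)"


section \<open>Well-definedness\<close>

lemma left_regular_sel [simp]:
  "carrier (left_regular R) = carrier R" "zero (left_regular R) = zero R"
  "add (left_regular R) = add R" "smult (left_regular R) = mult R"
  by (simp_all add: left_regular_def)

lemma right_regular_sel [simp]:
  "carrier (right_regular R) = carrier R" "zero (right_regular R) = zero R"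
  "add (right_regular R) = add R" "a \<odot>\<^bsub>right_regular R\<^esub> x = x \<otimes>\<^bsub>R\<^esub> a"
  by (simp_all add: right_regular_def)

lemma left_dual_sel:
  "carrier (left_dual R M) = module_hom R M (left_regular R) \<inter> extensional (carrier M)"
  "zero (left_dual R M) = (\<lambda>x\<in>carrier M. \<zero>\<^bsub>R\<^esub>)"
  "f \<oplus>\<^bsub>left_dual R M\<^esub> g = (\<lambda>x\<in>carrier M. f x \<oplus>\<^bsub>R\<^esub> g x)"
  "a \<odot>\<^bsub>left_dual R M\<^esub> f = (\<lambda>x\<in>carrier M. f x \<otimes>\<^bsub>R\<^esub> a)"
  by (simp_all add: left_dual_def)

lemma right_dual_sel:
  "carrier (right_dual R M) = module_hom R M (right_regular R) \<inter> extensional (carrier M)"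
  "zero (right_dual R M) = (\<lambda>x\<in>carrier M. \<zero>\<^bsub>R\<^esub>)"
  "f \<oplus>\<^bsub>right_dual R M\<^esub> g = (\<lambda>x\<in>carrier M. f x \<oplus>\<^bsub>R\<^esub> g x)"
  "a \<odot>\<^bsub>right_dual R M\<^esub> f = (\<lambda>x\<in>carrier M. a \<otimes>\<^bsub>R\<^esub> f x)"
  by (simp_all add: right_dual_def)

lemma (in ring) left_regular_left_module: "left_module R (left_regular R)"
proof -
  have "abelian_group (left_regular R)"
    by (rule abelian_groupI)
      (auto simp: a_assoc intro: a_comm bexI[of _ "\<ominus> x" for x] l_neg)
  then show ?thesis
    by (intro left_module.intro left_module_axioms.intro ring_axioms)
      (auto simp: l_distr r_distr m_assoc)
qed

lemma (in left_module) left_dual_right_module: "right_module R (left_dual R M)"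
proof -
  have "abelian_group (left_dual R M)"
  proof (rule abelian_groupI, goal_cases)
    case (6 f)
    have "(\<lambda>x\<in>carrier M. \<ominus> f x) \<in> carrier (left_dual R M)"
      using 6 by (auto simp: left_dual_sel module_hom_def R.minus_add R.r_minus Pi_iff)
    moreover have "(\<lambda>x\<in>carrier M. \<ominus> f x) \<oplus>\<^bsub>left_dual R M\<^esub> f = \<zero>\<^bsub>left_dual R M\<^esub>"
      using 6 by (auto simp: left_dual_sel module_hom_def R.l_neg Pi_iff)
    ultimately show ?case by blast
  next
    case (5 f)
    then show ?case
      by (intro ext) (auto simp: left_dual_sel module_hom_def Pi_iff extensional_def)
  qed (auto simp: left_dual_sel module_hom_def Pi_iff R.a_ac R.r_distr
        intro!: restrict_ext)
  then show ?thesis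
    by (intro right_module.intro right_module_axioms.intro R.ring_axioms)
      (auto simp: left_dual_sel module_hom_def Pi_iff R.m_assoc R.l_distr R.r_distr
        extensional_def fun_eq_iff)
qed

lemma (in right_module) right_dual_left_module: "left_module R (right_dual R M)"
proof -
  have "abelian_group (right_dual R M)"
  proof (rule abelian_groupI, goal_cases)
    case (6 f)
    have "(\<lambda>x\<in>carrier M. \<ominus> f x) \<in> carrier (right_dual R M)"
      using 6 by (auto simp: right_dual_sel module_hom_def R.minus_add R.l_minus Pi_iff)
    moreover have "(\<lambda>x\<in>carrier M. \<ominus> f x) \<oplus>\<^bsub>right_dual R M\<^esub> f = \<zero>\<^bsub>right_dual R M\<^esub>"
      using 6 by (auto simp: right_dual_sel module_hom_def R.l_neg Pi_iff)
    ultimately show ?case by blast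
  next
    case (5 f)
    then show ?case
      by (intro ext) (auto simp: right_dual_sel module_hom_def Pi_iff extensional_def)
  qed (auto simp: right_dual_sel module_hom_def Pi_iff R.a_ac R.l_distr
        intro!: restrict_ext)
  then show ?thesis
    by (intro left_module.intro left_module_axioms.intro R.ring_axioms)
      (auto simp: right_dual_sel module_hom_def Pi_iff R.m_assoc R.l_distr R.r_distr
        extensional_def fun_eq_iff)
qed

lemma (in left_module) canonical_map_hom:
  "canonical_map R M \<in> module_hom R M (bidual R M)"
proof -
  interpret D: right_module R "left_dual R M" by (rule left_dual_right_module)
  have "canonical_map R M m \<in> carrier (bidual R M)" if "m \<in> carrier M" for m
    using that D.M.add.m_closed D.smult_closed
    by (auto simp: bidual_def canonical_map_def right_dual_sel module_hom_def)
      (auto simp: left_dual_sel module_hom_def)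
  then show ?thesis
    by (auto simp: module_hom_def bidual_def canonical_map_def right_dual_sel
        intro!: restrict_ext) (auto simp: left_dual_sel module_hom_def)
qed

end

theory Submission
  imports Defs
begin

text \<open>
  Write \<open>h\<close> for the canonical map from \<open>M\<close> to \<open>M\<^sup>*\<^sup>*\<close> and let \<open>g\<close> be any isomorphism from \<open>M\<close> to
  \<open>M\<^sup>*\<^sup>*\<close>. The bidual is a dual, and every homomorphism from a module into a dual extends along the
  canonical map: there is an endomorphism \<open>q\<close> of \<open>M\<^sup>*\<^sup>*\<close> with \<open>q h = g\<close>
  (\<open>hom_to_bidual_factors_canonical_map\<close>). So \<open>h\<close> is injective, and the endomorphisms
  \<open>u = g\<^sup>-\<^sup>1 q g\<close> and \<open>v = g\<^sup>-\<^sup>1 h\<close> of \<open>M\<close> satisfy \<open>u v = 1\<close>. As soon as this forces \<open>v\<close> to be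
  surjective, \<open>h = g v\<close> is an isomorphism. The theorem is thus reduced to the assertion
  \<open>right_invertible_endo_surj\<close> that \<open>M\<close> is Dedekind-finite.

  Over a left Noetherian ring every surjective endomorphism \<open>u\<close> of \<open>M\<close> is injective, because the
  kernels of its powers form an ascending chain. Over a semi-local ring with radical \<open>J\<close> the same
  argument applies to \<open>M / J M\<close>, because a semisimple ring is left Noetherian. It shows that
  \<open>ker u \<subseteq> J M\<close>, hence \<open>M = v M + J M\<close>, and Nakayama's lemma gives \<open>v M = M\<close>. If the ring is a
  module-finite algebra over a commutative ring, then \<open>M\<close> is finitely generated over that
  commutative ring, and surjective endomorphisms are injective by Vasconcelos' theorem
  (\<open>surj_endo_inj_cring\<close>).
\<close>

section \<open>Submodules and homomorphisms\<close>

lemma module_hom_comp: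
  "f \<in> module_hom R M N \<Longrightarrow> g \<in> module_hom R N P \<Longrightarrow> g \<circ> f \<in> module_hom R M P"
  by (auto simp: module_hom_def Pi_iff)

context left_module
begin

lemma smult_zero_left: "x \<in> carrier M \<Longrightarrow> \<zero> \<odot>\<^bsub>M\<^esub> x = \<zero>\<^bsub>M\<^esub>"
  using smult_l_distr[of "\<zero>" "\<zero>" x] M.add.l_cancel_one' by simp

lemma smult_zero_right: "a \<in> carrier R \<Longrightarrow> a \<odot>\<^bsub>M\<^esub> \<zero>\<^bsub>M\<^esub> = \<zero>\<^bsub>M\<^esub>"
  using smult_r_distr[of a "\<zero>\<^bsub>M\<^esub>" "\<zero>\<^bsub>M\<^esub>"] M.add.l_cancel_one' by simp

lemma smult_l_minus:
  assumes "a \<in> carrier R" "x \<in> carrier M"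
  shows "(\<ominus> a) \<odot>\<^bsub>M\<^esub> x = \<ominus>\<^bsub>M\<^esub> (a \<odot>\<^bsub>M\<^esub> x)"
proof -
  have "(\<ominus> a) \<odot>\<^bsub>M\<^esub> x \<oplus>\<^bsub>M\<^esub> a \<odot>\<^bsub>M\<^esub> x = \<zero>\<^bsub>M\<^esub>"
    using assms smult_l_distr[of "\<ominus> a" a x] by (simp add: R.l_neg smult_zero_left)
  then show ?thesis
    using assms by (intro M.minus_equality[symmetric]) auto
qed

lemma smult_minus_one: "x \<in> carrier M \<Longrightarrow> (\<ominus> \<one>) \<odot>\<^bsub>M\<^esub> x = \<ominus>\<^bsub>M\<^esub> x"
  by (simp add: smult_l_minus)

text \<open>
  Negatives are multiples by the scalar \<open>- 1\<close>, so that closure under addition and under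
  scalars includes closure under negatives.
\<close>

lemma submodule_iff:
  "submodule H R M \<longleftrightarrow> H \<subseteq> carrier M \<and> \<zero>\<^bsub>M\<^esub> \<in> H \<and>
    (\<forall>x\<in>H. \<forall>y\<in>H. x \<oplus>\<^bsub>M\<^esub> y \<in> H) \<and> (\<forall>a\<in>carrier R. \<forall>x\<in>H. a \<odot>\<^bsub>M\<^esub> x \<in> H)"
  (is "?L \<longleftrightarrow> ?R")
proof
  assume ?L
  then interpret H: submodule H R M .
  show ?R
    using H.subset H.one_closed H.m_closed H.smult_closed by auto
next
  assume H: ?R
  have "\<ominus>\<^bsub>M\<^esub> x \<in> H" if "x \<in> H" for x
    using H that smult_minus_one[of x] R.a_inv_closed[OF R.one_closed] by (metis subsetD)
  then show ?L
    using H by unfold_locales (auto simp: a_inv_def)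
qed

lemma submodule_minus:
  assumes "submodule H R M" "x \<in> H" "y \<in> H"
  shows "x \<ominus>\<^bsub>M\<^esub> y \<in> H"
proof -
  have "\<ominus>\<^bsub>M\<^esub> y \<in> H"
    using assms smult_minus_one[of y] R.a_inv_closed[OF R.one_closed]
    unfolding submodule_iff by (metis subsetD)
  then show ?thesis
    using assms unfolding submodule_iff M.minus_eq by blast
qed

lemma hom_zero:
  assumes "left_module R N" "f \<in> module_hom R M N"
  shows "f \<zero>\<^bsub>M\<^esub> = \<zero>\<^bsub>N\<^esub>"
proof -
  have "f (\<zero> \<odot>\<^bsub>M\<^esub> \<zero>\<^bsub>M\<^esub>) = \<zero> \<odot>\<^bsub>N\<^esub> f \<zero>\<^bsub>M\<^esub>" "f \<zero>\<^bsub>M\<^esub> \<in> carrier N"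
    using assms by (auto simp: module_hom_def)
  then show ?thesis
    using left_module.smult_zero_left[OF assms(1)] smult_zero_left[of "\<zero>\<^bsub>M\<^esub>"] by simp
qed

lemma hom_minus:
  assumes N: "left_module R N" and f: "f \<in> module_hom R M N"
    and x: "x \<in> carrier M" and y: "y \<in> carrier M"
  shows "f (x \<ominus>\<^bsub>M\<^esub> y) = f x \<ominus>\<^bsub>N\<^esub> f y"
proof -
  interpret N: left_module R N by fact
  have "f ((\<ominus> \<one>) \<odot>\<^bsub>M\<^esub> y) = (\<ominus> \<one>) \<odot>\<^bsub>N\<^esub> f y" "f y \<in> carrier N"
    using f y by (auto simp: module_hom_def)
  then have "f (\<ominus>\<^bsub>M\<^esub> y) = \<ominus>\<^bsub>N\<^esub> f y"
    using smult_minus_one[OF y] N.smult_minus_one by simp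
  moreover have "f (x \<oplus>\<^bsub>M\<^esub> (\<ominus>\<^bsub>M\<^esub> y)) = f x \<oplus>\<^bsub>N\<^esub> f (\<ominus>\<^bsub>M\<^esub> y)"
    using f x y by (auto simp: module_hom_def)
  ultimately show ?thesis
    by (simp add: M.minus_eq N.minus_eq)
qed

lemma finitely_generated_iff:
  "finitely_generated R M \<longleftrightarrow> (\<exists>A. finite A \<and> A \<subseteq> carrier M \<and>
    (\<forall>H. submodule H R M \<and> A \<subseteq> H \<longrightarrow> H = carrier M))"
proof -
  have carr: "submodule (carrier M) R M"
    by (simp add: submodule_iff)
  have "module_span R M A = carrier M \<longleftrightarrow> (\<forall>H. submodule H R M \<and> A \<subseteq> H \<longrightarrow> H = carrier M)"
    if "A \<subseteq> carrier M" for A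
  proof -
    have "module_span R M A \<subseteq> carrier M"
      using carr that by (auto simp: module_span_def)
    then show ?thesis
      unfolding module_span_def by (auto simp: submodule_iff)
  qed
  then show ?thesis
    unfolding finitely_generated_def by meson
qed

lemma module_span_submodule:
  assumes "A \<subseteq> carrier M"
  shows "submodule (module_span R M A) R M"
proof -
  let ?F = "{H. submodule H R M \<and> A \<subseteq> H}"
  have "carrier M \<in> ?F"
    using assms by (simp add: submodule_iff)
  moreover have "\<zero>\<^bsub>M\<^esub> \<in> H" "x \<in> H \<Longrightarrow> y \<in> H \<Longrightarrow> x \<oplus>\<^bsub>M\<^esub> y \<in> H"
    "a \<in> carrier R \<Longrightarrow> x \<in> H \<Longrightarrow> a \<odot>\<^bsub>M\<^esub> x \<in> H" if "H \<in> ?F" for H x y a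
    using that by (simp_all add: submodule_iff)
  ultimately show ?thesis
    unfolding submodule_iff[of "module_span R M A"] unfolding module_span_def by blast
qed

lemma submodule_vimage:
  assumes "left_module R N" "f \<in> module_hom R M N" "submodule H R N"
  shows "submodule {x \<in> carrier M. f x \<in> H} R M"
  using assms hom_zero[OF assms(1,2)] unfolding submodule_iff left_module.submodule_iff[OF assms(1)]
  by (auto simp: module_hom_def)

lemma submodule_image:
  assumes "left_module R N" "f \<in> module_hom R M N" "submodule H R M"
  shows "submodule (f ` H) R N"
  unfolding left_module.submodule_iff[OF assms(1)]
proof (intro conjI ballI)
  have H: "H \<subseteq> carrier M" "\<zero>\<^bsub>M\<^esub> \<in> H" "\<And>x y. x \<in> H \<Longrightarrow> y \<in> H \<Longrightarrow> x \<oplus>\<^bsub>M\<^esub> y \<in> H"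
    "\<And>a x. a \<in> carrier R \<Longrightarrow> x \<in> H \<Longrightarrow> a \<odot>\<^bsub>M\<^esub> x \<in> H"
    using assms(3) unfolding submodule_iff by auto
  have f: "f x \<in> carrier N" "f (x \<oplus>\<^bsub>M\<^esub> y) = f x \<oplus>\<^bsub>N\<^esub> f y" "f (a \<odot>\<^bsub>M\<^esub> x) = a \<odot>\<^bsub>N\<^esub> f x"
    if "x \<in> H" "y \<in> H" "a \<in> carrier R" for x y a
    using that subsetD[OF H(1)] assms(2) by (auto simp: module_hom_def Pi_iff)
  show "f ` H \<subseteq> carrier N"
    using f(1) by blast
  show "\<zero>\<^bsub>N\<^esub> \<in> f ` H"
    using imageI[OF H(2), of f] hom_zero[OF assms(1,2)] by simp
  show "x \<oplus>\<^bsub>N\<^esub> y \<in> f ` H" if "x \<in> f ` H" "y \<in> f ` H" for x y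
    using that H(3) by (auto simp: f(2)[OF _ _ R.zero_closed, symmetric])
  show "a \<odot>\<^bsub>N\<^esub> x \<in> f ` H" if "a \<in> carrier R" "x \<in> f ` H" for x a
    using that H(4) by (auto simp: f(3)[symmetric])
qed

lemma module_hom_funpow: "f \<in> module_hom R M M \<Longrightarrow> f ^^ n \<in> module_hom R M M"
  by (induction n) (auto simp: module_hom_def Pi_iff)

end

definition adjoin ::
    "('a, 'b) ring_scheme \<Rightarrow> ('a, 'm, 'c) module_scheme \<Rightarrow> 'm set \<Rightarrow> 'm \<Rightarrow> 'm set"
  where "adjoin R M H m = {h \<oplus>\<^bsub>M\<^esub> a \<odot>\<^bsub>M\<^esub> m | h a. h \<in> H \<and> a \<in> carrier R}"

lemma (in left_module) adjoin_submodule: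
  assumes H: "submodule H R M" and m: "m \<in> carrier M"
  shows "submodule (adjoin R M H m) R M" "H \<subseteq> adjoin R M H m" "m \<in> adjoin R M H m"
proof -
  have h: "H \<subseteq> carrier M" "\<zero>\<^bsub>M\<^esub> \<in> H" "\<And>x y. x \<in> H \<Longrightarrow> y \<in> H \<Longrightarrow> x \<oplus>\<^bsub>M\<^esub> y \<in> H"
    "\<And>a x. a \<in> carrier R \<Longrightarrow> x \<in> H \<Longrightarrow> a \<odot>\<^bsub>M\<^esub> x \<in> H"
    using H unfolding submodule_iff by auto
  have adjI: "x \<in> adjoin R M H m" if "x = h \<oplus>\<^bsub>M\<^esub> a \<odot>\<^bsub>M\<^esub> m" "h \<in> H" "a \<in> carrier R" for x h a
    using that by (auto simp: adjoin_def)
  show sub: "H \<subseteq> adjoin R M H m"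
    using h(1) m by (auto intro!: adjI[of _ _ "\<zero>"] simp: smult_zero_left)
  show "m \<in> adjoin R M H m"
    using h(2) m by (auto intro!: adjI[of _ "\<zero>\<^bsub>M\<^esub>" "\<one>"])
  show "submodule (adjoin R M H m) R M"
    unfolding submodule_iff
  proof (intro conjI ballI)
    show "adjoin R M H m \<subseteq> carrier M"
      using h(1) m by (auto simp: adjoin_def)
    show "\<zero>\<^bsub>M\<^esub> \<in> adjoin R M H m"
      using sub h(2) by blast
    fix x assume "x \<in> adjoin R M H m"
    then obtain p a where x: "x = p \<oplus>\<^bsub>M\<^esub> a \<odot>\<^bsub>M\<^esub> m" "p \<in> H" "a \<in> carrier R"
      by (auto simp: adjoin_def)
    then have p: "p \<in> carrier M" using h(1) by blast
    show "x \<oplus>\<^bsub>M\<^esub> y \<in> adjoin R M H m" if "y \<in> adjoin R M H m" for y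
    proof -
      obtain q b where y: "y = q \<oplus>\<^bsub>M\<^esub> b \<odot>\<^bsub>M\<^esub> m" "q \<in> H" "b \<in> carrier R"
        using \<open>y \<in> adjoin R M H m\<close> by (auto simp: adjoin_def)
      then have q: "q \<in> carrier M" using h(1) by blast
      have "x \<oplus>\<^bsub>M\<^esub> y = (p \<oplus>\<^bsub>M\<^esub> q) \<oplus>\<^bsub>M\<^esub> (a \<oplus> b) \<odot>\<^bsub>M\<^esub> m"
        using x y p q m by (simp add: smult_l_distr M.a_ac)
      then show ?thesis
        using x(2,3) y(2,3) h(3) by (intro adjI[of _ "p \<oplus>\<^bsub>M\<^esub> q" "a \<oplus> b"]) auto
    qed
    show "c \<odot>\<^bsub>M\<^esub> x \<in> adjoin R M H m" if c: "c \<in> carrier R" for c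
      using x p m c h(4)
      by (intro adjI[of _ "c \<odot>\<^bsub>M\<^esub> p" "c \<otimes> a"]) (auto simp: smult_r_distr smult_assoc)
  qed
qed


section \<open>Ascending chains\<close>

text \<open>
  The ascending chain condition for the submodules of \<open>M\<close> that contain \<open>W\<close>, in other
  words for the submodules of \<open>M / W\<close>. Stating it inside \<open>M\<close> avoids quotient modules. The
  values of interest are \<open>W = 0\<close> for Noetherian rings and \<open>W = J M\<close>, with \<open>J\<close> the
  Jacobson radical, for semi-local rings.
\<close>

definition acc_above ::
    "('a, 'b) ring_scheme \<Rightarrow> ('a, 'm, 'c) module_scheme \<Rightarrow> 'm set \<Rightarrow> bool"
  where "acc_above R M W \<longleftrightarrow>
    (\<forall>N :: nat \<Rightarrow> 'm set. (\<forall>n. submodule (N n) R M \<and> W \<subseteq> N n \<and> N n \<subseteq> N (Suc n)) \<longrightarrow>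
      (\<exists>k. \<forall>n\<ge>k. N n = N k))"

text \<open>
  This is the statement that finitely generated modules over Noetherian rings are Noetherian,
  relative to \<open>J\<close> and \<open>W\<close>. Say that a submodule \<open>T\<close> absorbs a chain \<open>N\<close> if the chain of
  the \<open>N n \<inter> T\<close> stabilises. Then \<open>W\<close> absorbs \<open>N\<close> because it lies in every member, and if
  \<open>T\<close> does, so does \<open>T + R m\<close>: the coefficients of \<open>m\<close> that occur in \<open>N n\<close> modulo \<open>T\<close> form
  an ascending chain of left ideals containing \<open>J\<close>. Adjoining the generators of \<open>M\<close> one by
  one reaches \<open>T = M\<close>.
\<close>

lemma (in left_module) acc_above_finitely_generated:
  assumes fg: "finitely_generated R M"
    and acc: "acc_above R (left_regular R) J"
    and J: "J \<subseteq> carrier R"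
    and W: "submodule W R M"
    and JW: "\<And>j x. j \<in> J \<Longrightarrow> x \<in> carrier M \<Longrightarrow> j \<odot>\<^bsub>M\<^esub> x \<in> W"
  shows "acc_above R M W"
  unfolding acc_above_def
proof (intro allI impI)
  fix N :: "nat \<Rightarrow> 'm set"
  assume N: "\<forall>n. submodule (N n) R M \<and> W \<subseteq> N n \<and> N n \<subseteq> N (Suc n)"
  have mono: "N k \<subseteq> N n" if "k \<le> n" for k n
    using N that by (simp add: lift_Suc_mono_le)
  have Nsub: "N n \<subseteq> carrier M" for n
    using N unfolding submodule_iff by blast
  have "\<exists>T. submodule T R M \<and> A \<union> W \<subseteq> T \<and> (\<exists>k. \<forall>n\<ge>k. N n \<inter> T = N k \<inter> T)"
    if "finite A" "A \<subseteq> carrier M" for A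
    using that
  proof (induction A)
    case empty
    have "N n \<inter> W = N 0 \<inter> W" for n using N by blast
    then show ?case using W by blast
  next
    case (insert m A)
    then obtain T k1 where T: "submodule T R M" "A \<union> W \<subseteq> T"
      and k1: "\<And>n. k1 \<le> n \<Longrightarrow> N n \<inter> T = N k1 \<inter> T" by auto
    have m: "m \<in> carrier M" using insert by auto
    have Tsub: "T \<subseteq> carrier M" using T(1) unfolding submodule_iff by blast
    \<comment> \<open>The coefficients that \<open>m\<close> can have in an element of \<open>N n\<close> modulo \<open>T\<close>.\<close>
    define I where "I n = {a \<in> carrier R. \<exists>t\<in>T. t \<oplus>\<^bsub>M\<^esub> a \<odot>\<^bsub>M\<^esub> m \<in> N n}" for n
    interpret L: left_module R "left_regular R"
      by (rule R.left_regular_left_module)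
    have "left_ideal (I n) R \<and> J \<subseteq> I n \<and> I n \<subseteq> I (Suc n)" for n
    proof (intro conjI)
      show "I n \<subseteq> I (Suc n)" using N by (auto simp: I_def)
      show "J \<subseteq> I n"
      proof
        fix j assume j: "j \<in> J"
        then have "\<zero>\<^bsub>M\<^esub> \<oplus>\<^bsub>M\<^esub> j \<odot>\<^bsub>M\<^esub> m \<in> N n"
          using JW[OF j m] N m W unfolding submodule_iff by (metis M.l_zero subsetD)
        moreover have "\<zero>\<^bsub>M\<^esub> \<in> T" using T(1) unfolding submodule_iff by blast
        ultimately show "j \<in> I n" using j J unfolding I_def by blast
      qed
      have Nn: "\<zero>\<^bsub>M\<^esub> \<in> N n" "\<And>x y. x \<in> N n \<Longrightarrow> y \<in> N n \<Longrightarrow> x \<oplus>\<^bsub>M\<^esub> y \<in> N n"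
        "\<And>a x. a \<in> carrier R \<Longrightarrow> x \<in> N n \<Longrightarrow> a \<odot>\<^bsub>M\<^esub> x \<in> N n"
        using N unfolding submodule_iff by auto
      have t: "\<zero>\<^bsub>M\<^esub> \<in> T" "\<And>x y. x \<in> T \<Longrightarrow> y \<in> T \<Longrightarrow> x \<oplus>\<^bsub>M\<^esub> y \<in> T"
        "\<And>a x. a \<in> carrier R \<Longrightarrow> x \<in> T \<Longrightarrow> a \<odot>\<^bsub>M\<^esub> x \<in> T"
        using T(1) unfolding submodule_iff by auto
      show "left_ideal (I n) R"
        unfolding L.submodule_iff
      proof (intro conjI ballI, simp_all)
        show "I n \<subseteq> carrier R" by (auto simp: I_def)
        show "\<zero> \<in> I n"
          using t(1) Nn(1) m by (auto simp: I_def smult_zero_left intro!: bexI[of _ "\<zero>\<^bsub>M\<^esub>"])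
        fix a assume "a \<in> I n"
        then obtain p where a: "a \<in> carrier R" "p \<in> T" "p \<oplus>\<^bsub>M\<^esub> a \<odot>\<^bsub>M\<^esub> m \<in> N n"
          by (auto simp: I_def)
        then have p: "p \<in> carrier M" using Tsub by blast
        show "a \<oplus> b \<in> I n" if bI: "b \<in> I n" for b
        proof -
          obtain q where b: "b \<in> carrier R" "q \<in> T" "q \<oplus>\<^bsub>M\<^esub> b \<odot>\<^bsub>M\<^esub> m \<in> N n"
            using bI by (auto simp: I_def)
          then have q: "q \<in> carrier M" using Tsub by blast
          have "(p \<oplus>\<^bsub>M\<^esub> q) \<oplus>\<^bsub>M\<^esub> (a \<oplus> b) \<odot>\<^bsub>M\<^esub> m =
              (p \<oplus>\<^bsub>M\<^esub> a \<odot>\<^bsub>M\<^esub> m) \<oplus>\<^bsub>M\<^esub> (q \<oplus>\<^bsub>M\<^esub> b \<odot>\<^bsub>M\<^esub> m)"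
            using a(1) b(1) p q m by (simp add: smult_l_distr M.a_ac)
          then show ?thesis
            using a b t(2) Nn(2) by (force simp: I_def)
        qed
        show "c \<otimes> a \<in> I n" if c: "c \<in> carrier R" for c
        proof -
          have "c \<odot>\<^bsub>M\<^esub> p \<oplus>\<^bsub>M\<^esub> (c \<otimes> a) \<odot>\<^bsub>M\<^esub> m = c \<odot>\<^bsub>M\<^esub> (p \<oplus>\<^bsub>M\<^esub> a \<odot>\<^bsub>M\<^esub> m)"
            using a(1) p m c by (simp add: smult_r_distr smult_assoc)
          then show ?thesis
            using a c t(3) Nn(3) by (force simp: I_def)
        qed
      qed
    qed
    then obtain k2 where k2: "\<And>n. k2 \<le> n \<Longrightarrow> I n = I k2"
      using acc unfolding acc_above_def by blast
    define k where "k = max k1 k2"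
    let ?T = "adjoin R M T m"
    have "N n \<inter> ?T \<subseteq> N k" if n: "k \<le> n" for n
    proof
      fix x assume x: "x \<in> N n \<inter> ?T"
      then obtain t a where xt: "x = t \<oplus>\<^bsub>M\<^esub> a \<odot>\<^bsub>M\<^esub> m" "t \<in> T" "a \<in> carrier R"
        by (auto simp: adjoin_def)
      then have "a \<in> I n" using x by (auto simp: I_def)
      then have "a \<in> I k" using k2[of n] k2[of k] n by (auto simp: k_def)
      then obtain s where s: "s \<in> T" "s \<oplus>\<^bsub>M\<^esub> a \<odot>\<^bsub>M\<^esub> m \<in> N k"
        by (auto simp: I_def)
      \<comment> \<open>The element \<open>x\<close> of \<open>N n\<close> and the element \<open>?y\<close> of \<open>N k\<close> below have the same coefficient
        at \<open>m\<close>, so that their difference lies in \<open>T\<close>.\<close>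
      have carr: "t \<in> carrier M" "s \<in> carrier M" "x \<in> carrier M" "a \<odot>\<^bsub>M\<^esub> m \<in> carrier M"
        using Tsub s xt x Nsub m by auto
      let ?y = "s \<oplus>\<^bsub>M\<^esub> a \<odot>\<^bsub>M\<^esub> m"
      have eq: "x \<ominus>\<^bsub>M\<^esub> ?y = t \<ominus>\<^bsub>M\<^esub> s"
      proof -
        have "x \<ominus>\<^bsub>M\<^esub> ?y = (t \<ominus>\<^bsub>M\<^esub> s) \<oplus>\<^bsub>M\<^esub> (a \<odot>\<^bsub>M\<^esub> m \<ominus>\<^bsub>M\<^esub> a \<odot>\<^bsub>M\<^esub> m)"
          using carr unfolding xt(1) by (simp add: M.minus_eq M.minus_add M.a_ac)
        then show ?thesis
          using carr by (simp add: M.minus_eq M.r_neg)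
      qed
      have "t \<ominus>\<^bsub>M\<^esub> s \<in> T"
        using submodule_minus[OF T(1)] s xt by blast
      moreover have "x \<ominus>\<^bsub>M\<^esub> ?y \<in> N n"
        using submodule_minus[of "N n"] N x s(2) mono[OF n] by blast
      ultimately have "x \<ominus>\<^bsub>M\<^esub> ?y \<in> N k"
        using eq k1[of n] k1[of k] n by (auto simp: k_def)
      moreover have "x = (x \<ominus>\<^bsub>M\<^esub> ?y) \<oplus>\<^bsub>M\<^esub> ?y"
        using carr by (simp add: M.minus_eq M.a_assoc M.l_neg)
      ultimately show "x \<in> N k"
        using N s(2) unfolding submodule_iff by metis
    qed
    then have "\<forall>n\<ge>k. N n \<inter> ?T = N k \<inter> ?T"
      using mono by blast
    moreover have "submodule ?T R M" "insert m A \<union> W \<subseteq> ?T"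
      using adjoin_submodule[OF T(1) m] T(2) by auto
    ultimately show ?case by blast
  qed
  then obtain T k where "T = carrier M" "\<And>n. k \<le> n \<Longrightarrow> N n \<inter> T = N k \<inter> T"
    using fg unfolding finitely_generated_iff by (metis le_supE)
  then show "\<exists>k. \<forall>n\<ge>k. N n = N k"
    using Nsub by (metis inf.absorb1)
qed

text \<open>
  A surjective endomorphism of a module with ascending chain condition is injective. Here this
  is said of the endomorphism that \<open>u\<close> induces on \<open>M / W\<close>: the kernels of its powers form the
  ascending chain \<open>N\<close>, and if two successive ones agree then, by surjectivity, the kernel of
  the endomorphism itself is zero.
\<close>

lemma (in left_module) surj_endo_reflects_acc_submodule:
  assumes acc: "acc_above R M W" and W: "submodule W R M"
    and u: "u \<in> module_hom R M M" "u ` carrier M = carrier M" "u ` W \<subseteq> W"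
    and x: "x \<in> carrier M" "u x \<in> W"
  shows "x \<in> W"
proof -
  define N where "N n = {x \<in> carrier M. (u ^^ n) x \<in> W}" for n
  have un: "u ^^ n \<in> module_hom R M M" for n
    by (rule module_hom_funpow[OF u(1)])
  have "W \<subseteq> N n" for n
  proof -
    have "(u ^^ n) y \<in> W" if "y \<in> W" for y
      using that u(3) by (induction n) auto
    then show ?thesis
      using W unfolding N_def submodule_iff by blast
  qed
  moreover have "submodule (N n) R M" for n
    unfolding N_def by (rule submodule_vimage[OF left_module_axioms un W])
  moreover have "N n \<subseteq> N (Suc n)" for n
    using u(3) by (auto simp: N_def)
  ultimately obtain k where k: "\<And>n. k \<le> n \<Longrightarrow> N n = N k"
    using acc unfolding acc_above_def by meson
  have "(u ^^ n) ` carrier M = carrier M" for n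
    using u(2) proof (induction n)
    case (Suc n)
    have "(u ^^ Suc n) ` carrier M = u ` (u ^^ n) ` carrier M" by auto
    then show ?case using Suc u(2) by simp
  qed simp
  then obtain y where y: "y \<in> carrier M" "x = (u ^^ k) y"
    using x(1) by (metis imageE)
  then have "y \<in> N (Suc k)"
    using x(2) by (simp add: N_def)
  then show ?thesis
    using k[of "Suc k"] y by (auto simp: N_def)
qed

lemma (in left_module) surj_endo_inj_noetherian:
  assumes "left_noetherian_ring R" and fg: "finitely_generated R M"
    and f: "f \<in> module_hom R M M" and surj: "f ` carrier M = carrier M"
  shows "inj_on f (carrier M)"
proof (rule inj_onI)
  have "acc_above R (left_regular R) {}"
    using assms(1) unfolding left_noetherian_ring_def acc_above_def by simp
  moreover have z: "submodule {\<zero>\<^bsub>M\<^esub>} R M"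
    by (simp add: submodule_iff smult_zero_right)
  ultimately have acc: "acc_above R M {\<zero>\<^bsub>M\<^esub>}"
    by (intro acc_above_finitely_generated[OF fg]) auto
  fix x y assume x: "x \<in> carrier M" and y: "y \<in> carrier M" and eq: "f x = f y"
  have fx: "f y \<in> carrier M" using f y by (auto simp: module_hom_def)
  then have "f (x \<ominus>\<^bsub>M\<^esub> y) = \<zero>\<^bsub>M\<^esub>"
    using hom_minus[OF left_module_axioms f x y] eq by (simp add: M.minus_eq M.r_neg)
  then have "x \<ominus>\<^bsub>M\<^esub> y \<in> {\<zero>\<^bsub>M\<^esub>}"
    using surj_endo_reflects_acc_submodule[OF acc z f surj _ M.minus_closed[OF x y]]
      hom_zero[OF left_module_axioms f] by simp
  then have "(x \<ominus>\<^bsub>M\<^esub> y) \<oplus>\<^bsub>M\<^esub> y = y"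
    using y by simp
  then show "x = y"
    using x y by (simp add: M.minus_eq M.a_assoc M.l_neg)
qed

section \<open>The Jacobson radical and Nakayama's lemma\<close>

text \<open>
  The notion for modules is needed besides the one for left ideals because the radical acts on
  \<open>M\<close> through the simple quotients \<open>M / P\<close>.
\<close>

definition maximal_submodule ::
    "'m set \<Rightarrow> ('a, 'b) ring_scheme \<Rightarrow> ('a, 'm, 'c) module_scheme \<Rightarrow> bool"
  where "maximal_submodule P R M \<longleftrightarrow> submodule P R M \<and> P \<noteq> carrier M \<and>
    (\<forall>K. submodule K R M \<and> P \<subseteq> K \<longrightarrow> K = P \<or> K = carrier M)"

lemma maximal_left_ideal_iff:
  "maximal_left_ideal I R \<longleftrightarrow> maximal_submodule I R (left_regular R)"
  by (simp add: maximal_left_ideal_def maximal_submodule_def)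

text \<open>
  Zorn's lemma applies because the union of a chain of proper submodules is proper: otherwise
  the finitely many generators would already lie in one member of the chain.
\<close>

lemma (in left_module) maximal_submodule_exists:
  assumes fg: "finitely_generated R M" and N: "submodule N R M" "N \<noteq> carrier M"
  obtains P where "maximal_submodule P R M" "N \<subseteq> P"
proof -
  obtain A where A: "finite A" "A \<subseteq> carrier M"
    "\<forall>H. submodule H R M \<and> A \<subseteq> H \<longrightarrow> H = carrier M"
    using fg unfolding finitely_generated_iff by blast
  let ?\<A> = "{H. submodule H R M \<and> N \<subseteq> H \<and> H \<noteq> carrier M}"
  have "\<exists>P\<in>?\<A>. \<forall>X\<in>?\<A>. P \<subseteq> X \<longrightarrow> X = P"
  proof (rule subset_Zorn_nonempty)
    show "?\<A> \<noteq> {}" using N by blast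
    fix \<C> assume ne: "\<C> \<noteq> {}" and chain: "subset.chain ?\<A> \<C>"
    have mem: "H \<in> \<C> \<Longrightarrow> H \<in> ?\<A>" for H
      using chain by (auto simp: subset.chain_def)
    have lin: "H \<in> \<C> \<Longrightarrow> K \<in> \<C> \<Longrightarrow> H \<subseteq> K \<or> K \<subseteq> H" for H K
      using chain by (auto simp: subset.chain_def)
    have "submodule (\<Union>\<C>) R M"
      unfolding submodule_iff
    proof (intro conjI ballI)
      show "\<Union>\<C> \<subseteq> carrier M" using mem unfolding submodule_iff by blast
      show "\<zero>\<^bsub>M\<^esub> \<in> \<Union>\<C>" using mem ne unfolding submodule_iff by blast
      show "x \<oplus>\<^bsub>M\<^esub> y \<in> \<Union>\<C>" if xy: "x \<in> \<Union>\<C>" "y \<in> \<Union>\<C>" for x y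
      proof -
        obtain H where "H \<in> \<C>" "x \<in> H" "y \<in> H" using xy lin by blast
        then show ?thesis using mem[of H] unfolding submodule_iff by blast
      qed
      show "a \<odot>\<^bsub>M\<^esub> x \<in> \<Union>\<C>" if "a \<in> carrier R" "x \<in> \<Union>\<C>" for a x
        using that mem unfolding submodule_iff by blast
    qed
    moreover have "\<Union>\<C> \<noteq> carrier M"
    proof
      assume "\<Union>\<C> = carrier M"
      then obtain H where "H \<in> \<C>" "A \<subseteq> H"
        using finite_subset_Union_chain[OF A(1) _ ne chain] A(2) by metis
      then show False using A(3) mem by blast
    qed
    ultimately show "\<Union>\<C> \<in> ?\<A>"
      using ne mem by blast
  qed
  then obtain P where P: "P \<in> ?\<A>" "\<forall>X\<in>?\<A>. P \<subseteq> X \<longrightarrow> X = P" ..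
  have "K = P \<or> K = carrier M" if "submodule K R M" "P \<subseteq> K" for K
    using P that by auto
  then have "maximal_submodule P R M"
    using P(1) by (simp add: maximal_submodule_def)
  then show thesis using that P(1) by simp
qed

text \<open>
  The left ideal is the annihilator of the class of \<open>x\<close> in the simple module \<open>M / P\<close>. A larger
  left ideal contains some \<open>k\<close> with \<open>k x \<notin> P\<close>; then \<open>k x\<close> generates \<open>M\<close> modulo \<open>P\<close>, so for
  every \<open>b\<close> there is an \<open>a\<close> with \<open>b x - a k x \<in> P\<close>.
\<close>

lemma (in left_module) colon_maximal_left_ideal:
  assumes P: "maximal_submodule P R M" and x: "x \<in> carrier M" "x \<notin> P"
  shows "maximal_left_ideal {a \<in> carrier R. a \<odot>\<^bsub>M\<^esub> x \<in> P} R"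
proof -
  interpret L: left_module R "left_regular R"
    by (rule R.left_regular_left_module)
  let ?I = "{a \<in> carrier R. a \<odot>\<^bsub>M\<^esub> x \<in> P}"
  have Ps: "submodule P R M" using P by (simp add: maximal_submodule_def)
  have hom: "(\<lambda>a. a \<odot>\<^bsub>M\<^esub> x) \<in> module_hom R (left_regular R) M"
    using x by (auto simp: module_hom_def smult_l_distr smult_assoc)
  have "submodule {a \<in> carrier (left_regular R). a \<odot>\<^bsub>M\<^esub> x \<in> P} R (left_regular R)"
    by (rule L.submodule_vimage[OF left_module_axioms hom Ps])
  then have "left_ideal ?I R"
    by simp
  moreover have "\<one> \<notin> ?I" using x by simp
  moreover have "K = carrier R" if K: "left_ideal K R" "?I \<subseteq> K" "K \<noteq> ?I" for K
  proof -
    have Kc: "K \<subseteq> carrier R" "\<And>a b. a \<in> K \<Longrightarrow> b \<in> K \<Longrightarrow> a \<oplus> b \<in> K"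
      "\<And>a b. a \<in> carrier R \<Longrightarrow> b \<in> K \<Longrightarrow> a \<otimes> b \<in> K"
      using K(1) unfolding L.submodule_iff by auto
    obtain k where k: "k \<in> K" "k \<in> carrier R" "k \<odot>\<^bsub>M\<^esub> x \<notin> P" using K Kc(1) by blast
    have kx: "k \<odot>\<^bsub>M\<^esub> x \<in> carrier M" using k x by simp
    have "adjoin R M P (k \<odot>\<^bsub>M\<^esub> x) = carrier M"
      using P adjoin_submodule[OF Ps kx] k(3) unfolding maximal_submodule_def by blast
    have "b \<in> K" if b: "b \<in> carrier R" for b
    proof -
      have "b \<odot>\<^bsub>M\<^esub> x \<in> adjoin R M P (k \<odot>\<^bsub>M\<^esub> x)"
        using \<open>_ = carrier M\<close> b x by simp
      then obtain p a where pa: "b \<odot>\<^bsub>M\<^esub> x = p \<oplus>\<^bsub>M\<^esub> a \<odot>\<^bsub>M\<^esub> (k \<odot>\<^bsub>M\<^esub> x)" "p \<in> P" "a \<in> carrier R"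
        by (auto simp: adjoin_def)
      have p: "p \<in> carrier M" using pa(2) Ps unfolding submodule_iff by blast
      have "(b \<ominus> a \<otimes> k) \<odot>\<^bsub>M\<^esub> x = b \<odot>\<^bsub>M\<^esub> x \<ominus>\<^bsub>M\<^esub> (a \<otimes> k) \<odot>\<^bsub>M\<^esub> x"
        using b pa(3) k x by (simp add: R.minus_eq M.minus_eq smult_l_distr smult_l_minus)
      also have "\<dots> = p"
        using pa p k x kx by (simp add: smult_assoc M.minus_eq M.a_assoc M.r_neg)
      finally have "b \<ominus> a \<otimes> k \<in> K"
        using pa b k K(2) by auto
      then have "(b \<ominus> a \<otimes> k) \<oplus> a \<otimes> k \<in> K"
        using Kc pa k by blast
      then show "b \<in> K"
        using b pa k by (simp add: R.minus_eq R.a_assoc R.l_neg)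
    qed
    then show ?thesis using Kc(1) by blast
  qed
  ultimately show ?thesis
    unfolding maximal_left_ideal_def using R.one_closed by blast
qed

text \<open>
  The radical annihilates simple modules. Both Nakayama's lemma and the fact that the radical
  is a right ideal are consequences.
\<close>

lemma (in left_module) jacobson_radical_smult:
  assumes "maximal_submodule P R M" "j \<in> jacobson_radical R" "x \<in> carrier M"
  shows "j \<odot>\<^bsub>M\<^esub> x \<in> P"
proof (cases "x \<in> P")
  case True
  then show ?thesis
    using assms by (auto simp: maximal_submodule_def submodule_iff jacobson_radical_def)
next
  case False
  then show ?thesis
    using colon_maximal_left_ideal[OF assms(1,3)] assms(2) by (auto simp: jacobson_radical_def)
qed

text \<open>
  The hypothesis \<open>gen\<close> expresses \<open>N + J M = M\<close> by saying that \<open>M\<close> is the only submodule that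
  contains both \<open>N\<close> and \<open>J M\<close>. A maximal submodule above a proper \<open>N\<close> would be another one.
\<close>

lemma (in left_module) nakayama:
  assumes fg: "finitely_generated R M" and N: "submodule N R M"
    and gen: "\<And>P. submodule P R M \<Longrightarrow> N \<subseteq> P \<Longrightarrow>
      (\<forall>j\<in>jacobson_radical R. \<forall>x\<in>carrier M. j \<odot>\<^bsub>M\<^esub> x \<in> P) \<Longrightarrow> P = carrier M"
  shows "N = carrier M"
proof (rule ccontr)
  assume "N \<noteq> carrier M"
  then obtain P where "maximal_submodule P R M" "N \<subseteq> P"
    using maximal_submodule_exists[OF fg N] by blast
  then show False
    using gen[of P] jacobson_radical_smult by (auto simp: maximal_submodule_def)
qed

lemma (in ring) jacobson_radical_ideal: "ideal (jacobson_radical R) R"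
proof -
  interpret L: left_module R "left_regular R"
    by (rule left_regular_left_module)
  have J: "left_ideal (jacobson_radical R) R"
    unfolding L.submodule_iff jacobson_radical_def maximal_left_ideal_def by auto
  have "j \<otimes> x \<in> jacobson_radical R"
    if "j \<in> jacobson_radical R" "x \<in> carrier R" for j x
    using that L.jacobson_radical_smult[of _ j x]
    by (auto simp: jacobson_radical_def maximal_left_ideal_iff)
  moreover have "x \<otimes> j \<in> jacobson_radical R"
    if "j \<in> jacobson_radical R" "x \<in> carrier R" for j x
    using J that unfolding L.submodule_iff by simp
  moreover have "\<ominus> j \<in> jacobson_radical R" if j: "j \<in> jacobson_radical R" for j
  proof -
    have "(\<ominus> \<one>) \<otimes> j \<in> jacobson_radical R"
      using J j unfolding L.submodule_iff by simp
    then show ?thesis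
      using j by (simp add: l_minus jacobson_radical_def)
  qed
  ultimately show ?thesis
    using J unfolding L.submodule_iff
    by (intro idealI ring_axioms add.subgroupI) (auto simp: a_inv_def)
qed

section \<open>Semi-local rings\<close>

text \<open>
  A complement \<open>K\<close> of the union of a chain makes the chain stabilise: the generators of \<open>M\<close>
  already lie in \<open>N k + K\<close> for some \<open>k\<close>, so \<open>N k + K = M\<close>, and since \<open>K\<close> meets the later
  members in zero only, they cannot be larger than \<open>N k\<close>.
\<close>

lemma (in left_module) acc_above_semisimple:
  assumes ss: "semisimple_module R M" and fg: "finitely_generated R M"
  shows "acc_above R M W"
  unfolding acc_above_def
proof (intro allI impI)
  fix N :: "nat \<Rightarrow> 'm set"
  assume N: "\<forall>n. submodule (N n) R M \<and> W \<subseteq> N n \<and> N n \<subseteq> N (Suc n)"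
  have mono: "N k \<subseteq> N n" if "k \<le> n" for k n
    using N that by (simp add: lift_Suc_mono_le)
  have Ns: "N n \<subseteq> carrier M" "\<zero>\<^bsub>M\<^esub> \<in> N n" for n
    using N unfolding submodule_iff by blast+
  have Nadd: "x \<oplus>\<^bsub>M\<^esub> y \<in> N n" if "x \<in> N n" "y \<in> N n" for x y n
    using N that unfolding submodule_iff by blast
  have Nsm: "a \<odot>\<^bsub>M\<^esub> x \<in> N n" if "x \<in> N n" "a \<in> carrier R" for x a n
    using N that unfolding submodule_iff by blast
  let ?U = "\<Union>n. N n"
  have "submodule ?U R M"
    unfolding submodule_iff
  proof (intro conjI ballI)
    show "?U \<subseteq> carrier M" using Ns by blast
    show "\<zero>\<^bsub>M\<^esub> \<in> ?U" using Ns by blast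
    show "x \<oplus>\<^bsub>M\<^esub> y \<in> ?U" if xy: "x \<in> ?U" "y \<in> ?U" for x y
    proof -
      obtain k l where "x \<in> N k" "y \<in> N l" using xy by blast
      then have "x \<in> N (max k l)" "y \<in> N (max k l)"
        using mono[of k "max k l"] mono[of l "max k l"] by auto
      then show ?thesis using Nadd by blast
    qed
    show "a \<odot>\<^bsub>M\<^esub> x \<in> ?U" if "a \<in> carrier R" "x \<in> ?U" for a x
      using that Nsm by blast
  qed
  then obtain K where K: "submodule K R M" "?U \<inter> K = {\<zero>\<^bsub>M\<^esub>}" "?U <+>\<^bsub>M\<^esub> K = carrier M"
    using ss unfolding semisimple_module_def by blast
  have Kc: "K \<subseteq> carrier M" using K(1) unfolding submodule_iff by blast
  obtain A where A: "finite A" "A \<subseteq> carrier M" "\<forall>H. submodule H R M \<and> A \<subseteq> H \<longrightarrow> H = carrier M"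
    using fg unfolding finitely_generated_iff by blast
  have NK: "submodule (N n <+>\<^bsub>M\<^esub> K) R M" for n
    unfolding submodule_iff
  proof (intro conjI ballI)
    have k: "\<zero>\<^bsub>M\<^esub> \<in> K" "\<And>x y. x \<in> K \<Longrightarrow> y \<in> K \<Longrightarrow> x \<oplus>\<^bsub>M\<^esub> y \<in> K"
      "\<And>a x. a \<in> carrier R \<Longrightarrow> x \<in> K \<Longrightarrow> a \<odot>\<^bsub>M\<^esub> x \<in> K"
      using K(1) unfolding submodule_iff by auto
    have I: "z \<in> N n <+>\<^bsub>M\<^esub> K" if "z = x \<oplus>\<^bsub>M\<^esub> y" "x \<in> N n" "y \<in> K" for x y z
      using that by (auto simp: set_add_def')
    show "N n <+>\<^bsub>M\<^esub> K \<subseteq> carrier M"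
      using Ns(1) Kc by (rule M.set_add_closed)
    show "\<zero>\<^bsub>M\<^esub> \<in> N n <+>\<^bsub>M\<^esub> K"
      by (rule I[OF _ Ns(2) k(1)]) simp
    fix x assume "x \<in> N n <+>\<^bsub>M\<^esub> K"
    then obtain p q where x: "x = p \<oplus>\<^bsub>M\<^esub> q" "p \<in> N n" "q \<in> K" by (auto simp: set_add_def')
    then have c: "p \<in> carrier M" "q \<in> carrier M" using Ns Kc by auto
    show "x \<oplus>\<^bsub>M\<^esub> y \<in> N n <+>\<^bsub>M\<^esub> K" if y: "y \<in> N n <+>\<^bsub>M\<^esub> K" for y
    proof -
      obtain p' q' where y: "y = p' \<oplus>\<^bsub>M\<^esub> q'" "p' \<in> N n" "q' \<in> K" using y by (auto simp: set_add_def')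
      then have "p' \<in> carrier M" "q' \<in> carrier M" using Ns Kc by auto
      then show ?thesis
        using x y c by (intro I[OF _ Nadd[OF x(2) y(2)] k(2)[OF x(3) y(3)]]) (simp add: M.a_ac)
    qed
    show "a \<odot>\<^bsub>M\<^esub> x \<in> N n <+>\<^bsub>M\<^esub> K" if a: "a \<in> carrier R" for a
      using c by (intro I[OF _ Nsm[OF x(2) a] k(3)[OF a x(3)]]) (simp add: x(1) smult_r_distr a)
  qed
  have NK_mono: "N k <+>\<^bsub>M\<^esub> K \<subseteq> N n <+>\<^bsub>M\<^esub> K" if "k \<le> n" for k n
    using mono[OF that] by (force simp: set_add_def')
  have "\<exists>k. A \<subseteq> N k <+>\<^bsub>M\<^esub> K"
    using A(1,2)
  proof (induction A)
    case (insert m A)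
    then obtain k where k: "A \<subseteq> N k <+>\<^bsub>M\<^esub> K" by auto
    have "m \<in> ?U <+>\<^bsub>M\<^esub> K" using insert.prems K(3) by simp
    then obtain l where l: "m \<in> N l <+>\<^bsub>M\<^esub> K" by (auto simp: set_add_def')
    then have "insert m A \<subseteq> N (max k l) <+>\<^bsub>M\<^esub> K"
      using k NK_mono[of k "max k l"] NK_mono[of l "max k l"] by auto
    then show ?case by blast
  qed simp
  then obtain k where k: "N k <+>\<^bsub>M\<^esub> K = carrier M" using A(3) NK by blast
  have "N n \<subseteq> N k" if n: "k \<le> n" for n
  proof
    fix x assume x: "x \<in> N n"
    then have "x \<in> N k <+>\<^bsub>M\<^esub> K" using k Ns by blast
    then obtain y z where yz: "x = y \<oplus>\<^bsub>M\<^esub> z" "y \<in> N k" "z \<in> K" by (auto simp: set_add_def')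
    then have c: "y \<in> carrier M" "z \<in> carrier M" using Ns Kc by auto
    have "x \<ominus>\<^bsub>M\<^esub> y = z"
      using c unfolding yz(1) by (simp add: M.minus_eq M.a_comm[of y z] M.a_assoc M.r_neg)
    moreover have "x \<ominus>\<^bsub>M\<^esub> y \<in> N n"
      using submodule_minus[of "N n" x y] N x yz(2) mono[OF n] by blast
    ultimately have "z \<in> ?U \<inter> K" using yz(3) by blast
    then have "z = \<zero>\<^bsub>M\<^esub>" using K(2) by simp
    then show "x \<in> N k" using yz c by simp
  qed
  then show "\<exists>k. \<forall>n\<ge>k. N n = N k" using mono by blast
qed

lemma (in ring) left_regular_finitely_generated: "finitely_generated R (left_regular R)"
proof -
  interpret L: left_module R "left_regular R"
    by (rule left_regular_left_module)
  have "H = carrier R" if "left_ideal H R" "\<one> \<in> H" for H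
  proof -
    have "H \<subseteq> carrier R" "\<forall>a\<in>carrier R. \<forall>x\<in>H. a \<otimes> x \<in> H"
      using that(1) unfolding L.submodule_iff by simp_all
    then show ?thesis
      using that(2) r_one by (metis subsetI subset_antisym)
  qed
  then show ?thesis
    unfolding L.finitely_generated_iff by (intro exI[of _ "{\<one>}"]) auto
qed

text \<open>
  Left ideals containing the kernel of a surjective homomorphism are determined by their images.
\<close>

lemma (in ring_hom_ring) acc_above_kernel:
  assumes surj: "h ` carrier R = carrier S"
    and acc: "acc_above S (left_regular S) {}"
  shows "acc_above R (left_regular R) {a \<in> carrier R. h a = \<zero>\<^bsub>S\<^esub>}"
  unfolding acc_above_def
proof (intro allI impI)
  interpret L: left_module R "left_regular R"
    by (rule R.left_regular_left_module)
  interpret T: left_module S "left_regular S"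
    by (rule S.left_regular_left_module)
  fix N :: "nat \<Rightarrow> 'a set"
  assume N: "\<forall>n. left_ideal (N n) R \<and> {a \<in> carrier R. h a = \<zero>\<^bsub>S\<^esub>} \<subseteq> N n \<and> N n \<subseteq> N (Suc n)"
  have mono: "N k \<subseteq> N n" if "k \<le> n" for k n
    using N that by (simp add: lift_Suc_mono_le)
  have Ns: "N n \<subseteq> carrier R" "\<zero> \<in> N n" for n
    using N unfolding L.submodule_iff by auto
  have Nadd: "x \<oplus> y \<in> N n" if "x \<in> N n" "y \<in> N n" for x y n
    using N that unfolding L.submodule_iff by simp
  have Nsm: "a \<otimes> x \<in> N n" if "x \<in> N n" "a \<in> carrier R" for x a n
    using N that unfolding L.submodule_iff by simp
  have "left_ideal (h ` N n) S" for n
    unfolding T.submodule_iff left_regular_sel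
  proof (intro conjI ballI)
    show "h ` N n \<subseteq> carrier S" using Ns(1) hom_closed by blast
    show "\<zero>\<^bsub>S\<^esub> \<in> h ` N n" using imageI[OF Ns(2), of h n] by simp
    show "x \<oplus>\<^bsub>S\<^esub> y \<in> h ` N n" if xy: "x \<in> h ` N n" "y \<in> h ` N n" for x y
    proof -
      obtain p q where p: "x = h p" "p \<in> N n" and q: "y = h q" "q \<in> N n" using xy by blast
      then have "h (p \<oplus> q) = x \<oplus>\<^bsub>S\<^esub> y" using Ns by (metis hom_add subsetD)
      then show ?thesis using Nadd[OF p(2) q(2)] by (metis imageI)
    qed
    show "a \<otimes>\<^bsub>S\<^esub> x \<in> h ` N n" if a: "a \<in> carrier S" and x: "x \<in> h ` N n" for a x
    proof -
      obtain b p where b: "a = h b" "b \<in> carrier R" and p: "x = h p" "p \<in> N n"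
        using a x surj by blast
      then have "h (b \<otimes> p) = a \<otimes>\<^bsub>S\<^esub> x" using Ns by (metis hom_mult subsetD)
      then show ?thesis using Nsm[OF p(2) b(2)] by (metis imageI)
    qed
  qed
  moreover have "h ` N n \<subseteq> h ` N (Suc n)" for n using N by blast
  ultimately have "\<exists>k. \<forall>n\<ge>k. h ` N n = h ` N k"
    using acc[unfolded acc_above_def, rule_format, of "\<lambda>n. h ` N n"] by blast
  then obtain k where k: "\<And>n. k \<le> n \<Longrightarrow> h ` N n = h ` N k"
    by blast
  have "N n \<subseteq> N k" if n: "k \<le> n" for n
  proof
    fix a assume a: "a \<in> N n"
    then obtain b where b: "b \<in> N k" "h a = h b" using k[OF n] by blast
    have c: "a \<in> carrier R" "b \<in> carrier R" using a b Ns by auto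
    then have "h (a \<ominus> b) = h a \<oplus>\<^bsub>S\<^esub> \<ominus>\<^bsub>S\<^esub> h b"
      unfolding R.minus_eq by simp
    also have "\<dots> = \<zero>\<^bsub>S\<^esub>"
      unfolding b(2) using c by (intro S.r_neg hom_closed)
    finally have "h (a \<ominus> b) = \<zero>\<^bsub>S\<^esub>" .
    then have "a \<ominus> b \<in> N k" using N c by blast
    then have "(a \<ominus> b) \<oplus> b \<in> N k" using Nadd b(1) by blast
    then show "a \<in> N k" using c by (simp add: R.minus_eq R.a_assoc R.l_neg)
  qed
  then show "\<exists>k. \<forall>n\<ge>k. N n = N k" using mono by blast
qed

lemma semilocal_acc_above_radical:
  assumes "semilocal_ring R"
  shows "acc_above R (left_regular R) (jacobson_radical R)"
proof -
  interpret R: ring R using assms by (simp add: semilocal_ring_def)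
  let ?J = "jacobson_radical R" and ?Q = "R Quot jacobson_radical R"
  interpret J: ideal ?J R by (rule R.jacobson_radical_ideal)
  have surj: "((+>\<^bsub>R\<^esub>) ?J) ` carrier R = carrier ?Q"
    unfolding FactRing_def partial_object.simps A_RCOSETS_def' by blast
  have ker: "{a \<in> carrier R. ?J +>\<^bsub>R\<^esub> a = \<zero>\<^bsub>?Q\<^esub>} = ?J"
  proof -
    have "\<zero>\<^bsub>?Q\<^esub> = ?J" by (simp add: FactRing_def)
    moreover have "?J +>\<^bsub>R\<^esub> a = ?J \<longleftrightarrow> a \<in> ?J" if "a \<in> carrier R" for a
    proof
      show "?J +>\<^bsub>R\<^esub> a = ?J \<Longrightarrow> a \<in> ?J" by (rule J.rcos_const_imp_mem[OF that])
      show "a \<in> ?J \<Longrightarrow> ?J +>\<^bsub>R\<^esub> a = ?J" by (rule J.a_rcos_const)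
    qed
    ultimately have "{a \<in> carrier R. ?J +>\<^bsub>R\<^esub> a = \<zero>\<^bsub>?Q\<^esub>} = {a \<in> carrier R. a \<in> ?J}"
      by (simp cong: conj_cong)
    then show ?thesis using J.a_subset by blast
  qed
  interpret h: ring_hom_ring R ?Q "(+>\<^bsub>R\<^esub>) ?J" by (rule J.rcos_ring_hom_ring)
  interpret Q: left_module ?Q "left_regular ?Q"
    by (rule h.S.left_regular_left_module)
  have "acc_above ?Q (left_regular ?Q) {}"
    using assms h.S.left_regular_finitely_generated
    by (intro Q.acc_above_semisimple) (auto simp: semilocal_ring_def semisimple_ring_def)
  moreover note surj
  moreover note ker
  ultimately show ?thesis
    using h.acc_above_kernel by metis
qed

text \<open>
  On \<open>M / J M\<close> the chain condition makes the endomorphism induced by \<open>u\<close> injective, so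
  \<open>ker u \<subseteq> J M\<close>. Since \<open>u v = 1\<close>, the module \<open>M\<close> is the sum of \<open>v M\<close> and \<open>ker u\<close>, and
  Nakayama's lemma gives \<open>v M = M\<close>. The right inverse \<open>v\<close> is essential to the argument: it
  supplies the complement \<open>v M\<close> of \<open>ker u\<close>.
\<close>

lemma (in left_module) right_invertible_endo_semilocal:
  assumes sl: "semilocal_ring R" and fg: "finitely_generated R M"
    and u: "u \<in> module_hom R M M" and v: "v \<in> module_hom R M M"
    and uv: "\<And>x. x \<in> carrier M \<Longrightarrow> u (v x) = x"
  shows "v ` carrier M = carrier M"
proof -
  let ?J = "jacobson_radical R"
  have uc: "u x \<in> carrier M" and vc: "v x \<in> carrier M" if "x \<in> carrier M" for x
    using that u v by (auto simp: module_hom_def)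
  have carr: "submodule (carrier M) R M"
    by (simp add: submodule_iff)
  define G where "G = {j \<odot>\<^bsub>M\<^esub> x | j x. j \<in> ?J \<and> x \<in> carrier M}"
  define W where "W = module_span R M G"
  have G: "G \<subseteq> carrier M" by (auto simp: G_def jacobson_radical_def)
  have W: "submodule W R M"
    unfolding W_def by (rule module_span_submodule[OF G])
  have GW: "G \<subseteq> W" by (auto simp: W_def module_span_def)
  have least: "W \<subseteq> H" if "submodule H R M" "G \<subseteq> H" for H
    using that by (auto simp: W_def module_span_def)
  have acc: "acc_above R M W"
    using GW by (intro acc_above_finitely_generated[OF fg semilocal_acc_above_radical[OF sl] _ W])
      (auto simp: G_def jacobson_radical_def)
  have uW: "u ` W \<subseteq> W"
  proof -
    have "u (j \<odot>\<^bsub>M\<^esub> x) \<in> W" if "j \<in> ?J" "x \<in> carrier M" for j x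
    proof -
      have "u (j \<odot>\<^bsub>M\<^esub> x) = j \<odot>\<^bsub>M\<^esub> u x"
        using that u by (auto simp: module_hom_def jacobson_radical_def)
      then show ?thesis using that uc GW by (auto simp: G_def)
    qed
    then have "G \<subseteq> {x \<in> carrier M. u x \<in> W}"
      using G unfolding G_def by blast
    then show ?thesis
      using least[OF submodule_vimage[OF left_module_axioms u W]] by blast
  qed
  have surj: "u ` carrier M = carrier M"
    using uc vc uv by (metis image_eqI image_subsetI subsetI subset_antisym)
  have ker: "x \<in> W" if "x \<in> carrier M" "u x = \<zero>\<^bsub>M\<^esub>" for x
    using surj_endo_reflects_acc_submodule[OF acc W u surj uW that(1)] that(2) W
    unfolding submodule_iff by metis
  show ?thesis
  proof (rule nakayama[OF fg submodule_image[OF left_module_axioms v carr]])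
    fix P assume P: "submodule P R M" "v ` carrier M \<subseteq> P"
      and JP: "\<forall>j\<in>?J. \<forall>x\<in>carrier M. j \<odot>\<^bsub>M\<^esub> x \<in> P"
    have WP: "W \<subseteq> P" using JP by (intro least[OF P(1)]) (auto simp: G_def)
    have "x \<in> P" if x: "x \<in> carrier M" for x
    proof -
      have c: "u x \<in> carrier M" "v (u x) \<in> carrier M" using x uc vc by auto
      have "u (x \<ominus>\<^bsub>M\<^esub> v (u x)) = \<zero>\<^bsub>M\<^esub>"
        using hom_minus[OF left_module_axioms u x c(2)] uv[OF c(1)] c(1)
        by (simp add: M.minus_eq M.r_neg)
      then have "x \<ominus>\<^bsub>M\<^esub> v (u x) \<in> P"
        using ker x c WP by blast
      moreover have "v (u x) \<in> P" using P(2) c by blast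
      ultimately have "(x \<ominus>\<^bsub>M\<^esub> v (u x)) \<oplus>\<^bsub>M\<^esub> v (u x) \<in> P"
        using P(1) unfolding submodule_iff by blast
      then show ?thesis
        using x c by (simp add: M.minus_eq M.a_assoc M.l_neg)
    qed
    then show "P = carrier M" using P(1) unfolding submodule_iff by blast
  qed
qed

section \<open>Module-finite algebras\<close>

text \<open>
  This is a theorem of Vasconcelos. Let \<open>M\<close> be a module over the polynomial ring \<open>R[X]\<close> with
  \<open>X\<close> acting as \<open>f\<close>; then \<open>X M = M\<close>, and Nakayama's lemma for the ideal \<open>(X)\<close> yields an element
  \<open>1 - X p\<close> that annihilates \<open>M\<close>, whence \<open>p\<close> acts as an inverse of \<open>f\<close>.

  What matters about \<open>R[X]\<close> is only that it acts through a commutative ring of endomorphisms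
  containing the scalars and \<open>f\<close>. The double commutant \<open>A\<close> of \<open>f\<close> in the endomorphism ring is
  such a ring: it is commutative because it lies in the commutant \<open>C\<close>, and its closure
  properties are immediate.

  Instead of a determinant, the version of Nakayama's lemma used here removes the generators one
  at a time (the fact \<open>key\<close>). Endomorphisms in \<open>A\<close> of the form \<open>1 - f a\<close> are called small. If a
  small \<open>w\<close> maps \<open>M\<close> into \<open>N + A m\<close>, then writing \<open>m = f m'\<close> and \<open>w m' = n + a m\<close> shows that
  the small endomorphism \<open>v = w - f a\<close> maps \<open>m\<close> into \<open>N\<close>; hence \<open>v w\<close> is small and maps all of
  \<open>M\<close> into \<open>N\<close>.
\<close>

lemma (in left_module) surj_endo_inj_cring:
  assumes "cring R" and fg: "finitely_generated R M"
    and f: "f \<in> module_hom R M M" and surj: "f ` carrier M = carrier M"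
  shows "inj_on f (carrier M)"
proof -
  interpret R: cring R by fact
  let ?E = "module_hom R M M"
  \<comment> \<open>The commutant of \<open>f\<close> and its double commutant; the scalars belong to both of them.\<close>
  define C where "C = {c \<in> ?E. \<forall>x\<in>carrier M. c (f x) = f (c x)}"
  define A where "A = {w \<in> ?E. \<forall>c\<in>C. \<forall>x\<in>carrier M. w (c x) = c (w x)}"
  have E1: "w x \<in> carrier M" if "w \<in> ?E" "x \<in> carrier M" for w x
    using that by (auto simp: module_hom_def)
  have E2: "w (x \<oplus>\<^bsub>M\<^esub> y) = w x \<oplus>\<^bsub>M\<^esub> w y"
    if "w \<in> ?E" "x \<in> carrier M" "y \<in> carrier M" for w x y
    using that by (auto simp: module_hom_def)
  have CE: "C \<subseteq> ?E" and AE: "A \<subseteq> ?E" by (auto simp: C_def A_def)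
  have AE': "a \<in> ?E" if "a \<in> A" for a using that AE by blast
  have CE': "a \<in> ?E" if "a \<in> C" for a using that CE by blast
  have smult_E: "(\<lambda>x. r \<odot>\<^bsub>M\<^esub> x) \<in> ?E" if "r \<in> carrier R" for r
    using that by (auto simp: module_hom_def smult_r_distr smult_assoc[symmetric] R.m_comm)
  have fC: "f \<in> C" using f by (simp add: C_def)
  have AC: "A \<subseteq> C" using fC by (auto simp: A_def C_def)
  have A_comm: "a (b x) = b (a x)" if "a \<in> A" "b \<in> A" "x \<in> carrier M" for a b x
    using that AC by (auto simp: A_def)
  have A_smult: "(\<lambda>x. r \<odot>\<^bsub>M\<^esub> x) \<in> A" if "r \<in> carrier R" for r
    using that smult_E[OF that] CE by (auto simp: A_def module_hom_def)
  have A_id: "(\<lambda>x. x) \<in> A" by (auto simp: A_def module_hom_def)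
  have A_f: "f \<in> A" using f by (auto simp: A_def C_def)
  have A_comp: "(\<lambda>x. a (b x)) \<in> A" if "a \<in> A" "b \<in> A" for a b
  proof -
    have "a (b (c x)) = c (a (b x))" if "c \<in> C" "x \<in> carrier M" for c x
      using that \<open>a \<in> A\<close> \<open>b \<in> A\<close> E1[OF AE'[OF \<open>b \<in> A\<close>], of x] by (simp add: A_def)
    then show ?thesis
      using module_hom_comp[OF AE'[OF that(2)] AE'[OF that(1)]] by (simp add: A_def comp_def)
  qed
  have A_add: "(\<lambda>x. a x \<oplus>\<^bsub>M\<^esub> b x) \<in> A" if ab: "a \<in> A" "b \<in> A" for a b
  proof -
    have "(\<lambda>x. a x \<oplus>\<^bsub>M\<^esub> b x) \<in> ?E"
      using AE'[OF ab(1)] AE'[OF ab(2)] by (auto simp: module_hom_def smult_r_distr Pi_iff M.a_ac)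
    moreover have "a (c x) \<oplus>\<^bsub>M\<^esub> b (c x) = c (a x \<oplus>\<^bsub>M\<^esub> b x)"
      if c: "c \<in> C" and x: "x \<in> carrier M" for c x
    proof -
      have "a (c x) = c (a x)" "b (c x) = c (b x)"
        using c x ab by (auto simp: A_def)
      then show ?thesis
        using E2[OF CE'[OF c], of "a x" "b x"] E1[OF AE'] ab x by auto
    qed
    ultimately show ?thesis by (auto simp: A_def)
  qed

  \<comment> \<open>The condition \<open>w = 1 - f a\<close>, written without subtraction.\<close>
  define small where "small w \<longleftrightarrow> w \<in> A \<and> (\<exists>a\<in>A. \<forall>x\<in>carrier M. x = w x \<oplus>\<^bsub>M\<^esub> f (a x))" for w
  have small_id: "small (\<lambda>x. x)"
    unfolding small_def
    using A_id A_smult[of \<zero>] hom_zero[OF left_module_axioms f]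
    by (auto simp: smult_zero_left intro!: bexI[of _ "\<lambda>x. \<zero> \<odot>\<^bsub>M\<^esub> x"])
  have small_comp: "small (\<lambda>x. v (w x))" if v: "small v" and w: "small w" for v w
  proof -
    obtain a b where a: "v \<in> A" "a \<in> A" "\<And>x. x \<in> carrier M \<Longrightarrow> x = v x \<oplus>\<^bsub>M\<^esub> f (a x)"
      and b: "w \<in> A" "b \<in> A" "\<And>x. x \<in> carrier M \<Longrightarrow> x = w x \<oplus>\<^bsub>M\<^esub> f (b x)"
      using v w unfolding small_def by metis
    \<comment> \<open>This is \<open>(1 - f a) (1 - f b) = 1 - f (a (1 - f b) + b)\<close>.\<close>
    have "x = v (w x) \<oplus>\<^bsub>M\<^esub> f (a (w x) \<oplus>\<^bsub>M\<^esub> b x)" if x: "x \<in> carrier M" for x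
    proof -
      have c: "w x \<in> carrier M" "v (w x) \<in> carrier M" "a (w x) \<in> carrier M" "b x \<in> carrier M"
        using E1[OF AE'] a b x by auto
      have "x = w x \<oplus>\<^bsub>M\<^esub> f (b x)" by (rule b(3)[OF x])
      also have "\<dots> = (v (w x) \<oplus>\<^bsub>M\<^esub> f (a (w x))) \<oplus>\<^bsub>M\<^esub> f (b x)"
        using a(3)[OF c(1)] by simp
      also have "\<dots> = v (w x) \<oplus>\<^bsub>M\<^esub> f (a (w x) \<oplus>\<^bsub>M\<^esub> b x)"
        using c E1[OF f] E2[OF f c(3,4)] by (simp add: M.a_assoc)
      finally show ?thesis .
    qed
    then show ?thesis
      unfolding small_def using A_comp[OF a(1) b(1)] A_add[OF A_comp[OF a(2) b(1)] b(2)]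
      by (auto intro!: bexI[of _ "\<lambda>x. a (w x) \<oplus>\<^bsub>M\<^esub> b x"])
  qed
  have small_diff: "small (\<lambda>x. w x \<oplus>\<^bsub>M\<^esub> (\<ominus> \<one>) \<odot>\<^bsub>M\<^esub> f (b x))" if w: "small w" and b: "b \<in> A" for w b
  proof -
    obtain a where a: "w \<in> A" "a \<in> A" "\<And>x. x \<in> carrier M \<Longrightarrow> x = w x \<oplus>\<^bsub>M\<^esub> f (a x)"
      using w unfolding small_def by blast
    have "x = (w x \<oplus>\<^bsub>M\<^esub> (\<ominus> \<one>) \<odot>\<^bsub>M\<^esub> f (b x)) \<oplus>\<^bsub>M\<^esub> f (a x \<oplus>\<^bsub>M\<^esub> b x)" if x: "x \<in> carrier M" for x
    proof -
      have c: "w x \<in> carrier M" "a x \<in> carrier M" "b x \<in> carrier M"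
          "f (a x) \<in> carrier M" "f (b x) \<in> carrier M"
        using E1[OF AE'] E1[OF f] a b x by auto
      have "(w x \<oplus>\<^bsub>M\<^esub> (\<ominus> \<one>) \<odot>\<^bsub>M\<^esub> f (b x)) \<oplus>\<^bsub>M\<^esub> f (a x \<oplus>\<^bsub>M\<^esub> b x)
          = w x \<oplus>\<^bsub>M\<^esub> f (a x) \<oplus>\<^bsub>M\<^esub> (f (b x) \<oplus>\<^bsub>M\<^esub> \<ominus>\<^bsub>M\<^esub> f (b x))"
        using c E2[OF f c(2,3)] by (simp add: smult_minus_one M.a_ac)
      then show ?thesis
        using c a(3)[OF x] x by (simp add: M.r_neg)
    qed
    moreover have "(\<lambda>x. w x \<oplus>\<^bsub>M\<^esub> (\<ominus> \<one>) \<odot>\<^bsub>M\<^esub> f (b x)) \<in> A"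
      using A_add[OF a(1) A_comp[OF A_smult[of "\<ominus> \<one>"] A_comp[OF A_f b]]] by simp
    ultimately show ?thesis
      unfolding small_def using A_add[OF a(2) b] by (auto intro!: bexI[of _ "\<lambda>x. a x \<oplus>\<^bsub>M\<^esub> b x"])
  qed

  \<comment> \<open>The submodules of \<open>M\<close> as a module over \<open>A\<close>.\<close>
  define stable where "stable H \<longleftrightarrow> submodule H R M \<and> (\<forall>a\<in>A. \<forall>x\<in>H. a x \<in> H)" for H
  have stableE: "H \<subseteq> carrier M" "\<zero>\<^bsub>M\<^esub> \<in> H" "\<And>x y. x \<in> H \<Longrightarrow> y \<in> H \<Longrightarrow> x \<oplus>\<^bsub>M\<^esub> y \<in> H"
    "\<And>a x. a \<in> A \<Longrightarrow> x \<in> H \<Longrightarrow> a x \<in> H" if "stable H" for H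
    using that unfolding stable_def submodule_iff by auto
  have stableI: "stable H" if "H \<subseteq> carrier M" "\<zero>\<^bsub>M\<^esub> \<in> H" "\<And>x y. x \<in> H \<Longrightarrow> y \<in> H \<Longrightarrow> x \<oplus>\<^bsub>M\<^esub> y \<in> H"
    "\<And>a x. a \<in> A \<Longrightarrow> x \<in> H \<Longrightarrow> a x \<in> H" for H
    using that A_smult unfolding stable_def submodule_iff by blast
  have key: "\<exists>w. small w \<and> w ` carrier M \<subseteq> N"
    if "finite F" "F \<subseteq> carrier M" "stable N"
      "\<And>H. stable H \<Longrightarrow> N \<union> F \<subseteq> H \<Longrightarrow> H = carrier M" for F N
    using that
  proof (induction F arbitrary: N)
    case empty
    then have "N = carrier M" by simp
    then show ?case using small_id by auto
  next
    case (insert m F)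
    have m: "m \<in> carrier M" using insert.prems(1) by simp
    note N = stableE[OF insert.prems(2)]
    define N' where "N' = {n \<oplus>\<^bsub>M\<^esub> a m | n a. n \<in> N \<and> a \<in> A}"
    have N'I: "x \<in> N'" if "x = n \<oplus>\<^bsub>M\<^esub> a m" "n \<in> N" "a \<in> A" for x n a
      using that by (auto simp: N'_def)
    have NN': "N \<subseteq> N'"
      using N(1) m A_smult[of \<zero>]
      by (auto intro!: N'I[of _ _ "\<lambda>x. \<zero> \<odot>\<^bsub>M\<^esub> x"] simp: smult_zero_left)
    have mN': "m \<in> N'"
      using N'I[of m "\<zero>\<^bsub>M\<^esub>" "\<lambda>x. x"] N(2) m A_id by simp
    have "stable N'"
    proof (rule stableI)
      show "N' \<subseteq> carrier M"
        using N(1) m E1[OF AE'] by (auto simp: N'_def)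
      show "\<zero>\<^bsub>M\<^esub> \<in> N'" using NN' N(2) by blast
      fix x assume "x \<in> N'"
      then obtain p a where x: "x = p \<oplus>\<^bsub>M\<^esub> a m" "p \<in> N" "a \<in> A" by (auto simp: N'_def)
      have c: "p \<in> carrier M" "a m \<in> carrier M" using x N(1) m E1[OF AE'] by auto
      show "x \<oplus>\<^bsub>M\<^esub> y \<in> N'" if y: "y \<in> N'" for y
      proof -
        obtain q b where y: "y = q \<oplus>\<^bsub>M\<^esub> b m" "q \<in> N" "b \<in> A" using y by (auto simp: N'_def)
        have d: "q \<in> carrier M" "b m \<in> carrier M" using y N(1) m E1[OF AE'] by auto
        show ?thesis
          using x y c d
          by (intro N'I[OF _ N(3)[OF x(2) y(2)] A_add[OF x(3) y(3)]]) (simp add: M.a_ac)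
      qed
      show "b x \<in> N'" if b: "b \<in> A" for b
        using x E2[OF AE'[OF b] c] by (intro N'I[OF _ N(4)[OF b x(2)] A_comp[OF b x(3)]]) simp
    qed
    moreover have "H = carrier M" if "stable H" "N' \<union> F \<subseteq> H" for H
      using insert.prems(3)[OF that(1)] that(2) NN' mN' by blast
    ultimately obtain w where w: "small w" "w ` carrier M \<subseteq> N'"
      using insert.IH[of N'] insert.prems(1) by blast
    obtain m' where m': "m' \<in> carrier M" "m = f m'" using m surj by blast
    then obtain n a where wm': "w m' = n \<oplus>\<^bsub>M\<^esub> a m" and n: "n \<in> N" and a: "a \<in> A"
      using w(2) by (auto simp: N'_def)
    define v where "v x = w x \<oplus>\<^bsub>M\<^esub> (\<ominus> \<one>) \<odot>\<^bsub>M\<^esub> f (a x)" for x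
    have v: "small v" unfolding v_def[abs_def] by (rule small_diff[OF w(1) a])
    then have vA: "v \<in> A" by (simp add: small_def)
    have wA: "w \<in> A" using w(1) by (simp add: small_def)
    have c: "n \<in> carrier M" "a m \<in> carrier M" "f n \<in> carrier M" "f (a m) \<in> carrier M"
      using n N(1) m a E1[OF AE'] E1[OF f] by auto
    have "w m = f n \<oplus>\<^bsub>M\<^esub> f (a m)"
      using A_comm[OF wA A_f m'(1)] m'(2) wm' E2[OF f c(1,2)] by simp
    then have "v m = f n"
      using c by (simp add: v_def smult_minus_one M.a_assoc M.r_neg)
    then have vm: "v m \<in> N" using N(4)[OF A_f n] by simp
    have "v (w x) \<in> N" if x: "x \<in> carrier M" for x
    proof -
      obtain p b where p: "w x = p \<oplus>\<^bsub>M\<^esub> b m" "p \<in> N" "b \<in> A"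
        using w(2) x by (auto simp: N'_def)
      have "v (p \<oplus>\<^bsub>M\<^esub> b m) = v p \<oplus>\<^bsub>M\<^esub> b (v m)"
        using E2[OF AE'[OF vA], of p "b m"] A_comm[OF vA p(3) m] N(1) p m E1[OF AE'[OF p(3)]]
        by auto
      then show ?thesis
        using p N(3)[OF N(4)[OF vA p(2)] N(4)[OF p(3) vm]] by simp
    qed
    then show ?case
      using small_comp[OF v w(1)] by blast
  qed
  have z: "stable {\<zero>\<^bsub>M\<^esub>}"
    using hom_zero[OF left_module_axioms AE'] by (intro stableI) auto
  obtain B where B: "finite B" "B \<subseteq> carrier M" "\<forall>H. submodule H R M \<and> B \<subseteq> H \<longrightarrow> H = carrier M"
    using fg unfolding finitely_generated_iff by blast
  have "\<exists>w. small w \<and> w ` carrier M \<subseteq> {\<zero>\<^bsub>M\<^esub>}"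
    using B(3) by (intro key[OF B(1,2) z]) (auto simp: stable_def)
  then obtain w where "small w" and w0: "w ` carrier M \<subseteq> {\<zero>\<^bsub>M\<^esub>}"
    by blast
  then obtain a where a: "a \<in> A" and wa: "\<And>x. x \<in> carrier M \<Longrightarrow> x = w x \<oplus>\<^bsub>M\<^esub> f (a x)"
    unfolding small_def by blast
  have w: "w x = \<zero>\<^bsub>M\<^esub>" if "x \<in> carrier M" for x
    using w0 that by blast
  show ?thesis
  proof (rule inj_on_inverseI)
    fix x assume x: "x \<in> carrier M"
    have "x = f (a x)"
      using wa[OF x] w[OF x] E1[OF f E1[OF AE'[OF a] x]] x by simp
    then show "a (f x) = x"
      using A_comm[OF A_f a x] by simp
  qed
qed

definition restrict_scalars ::
    "('r \<Rightarrow> 'a) \<Rightarrow> ('a, 'm, 'c) module_scheme \<Rightarrow> ('r, 'm) module"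
  where "restrict_scalars \<phi> M =
    \<lparr>carrier = carrier M, mult = mult M, one = one M, zero = zero M, add = add M,
     smult = (\<lambda>r x. \<phi> r \<odot>\<^bsub>M\<^esub> x)\<rparr>"

lemma restrict_scalars_sel [simp]:
  "carrier (restrict_scalars \<phi> M) = carrier M" "zero (restrict_scalars \<phi> M) = zero M"
  "add (restrict_scalars \<phi> M) = add M" "r \<odot>\<^bsub>restrict_scalars \<phi> M\<^esub> x = \<phi> r \<odot>\<^bsub>M\<^esub> x"
  by (simp_all add: restrict_scalars_def)

lemma restrict_scalars_left_regular:
  "restrict_scalars \<phi> (left_regular S) = scalar_module \<phi> S"
  by (simp add: restrict_scalars_def scalar_module_def left_regular_def)

lemma (in left_module) restrict_scalars_left_module:
  assumes S: "ring S" and \<phi>: "\<phi> \<in> ring_hom S R"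
  shows "left_module S (restrict_scalars \<phi> M)"
proof -
  interpret S: ring S by fact
  have "abelian_group (restrict_scalars \<phi> M)"
    by (rule abelian_groupI)
      (auto simp: M.a_assoc intro: M.a_comm bexI[of _ "\<ominus>\<^bsub>M\<^esub> x" for x] M.l_neg)
  then show ?thesis
    using \<phi> by (intro left_module.intro left_module_axioms.intro S)
      (auto simp: ring_hom_def Pi_iff smult_l_distr smult_r_distr smult_assoc)
qed

text \<open>
  The products of generators of \<open>R\<close> over \<open>S\<close> with generators of \<open>M\<close> over \<open>R\<close> generate \<open>M\<close>
  over \<open>S\<close>. An \<open>S\<close>-submodule \<open>H\<close> containing them contains \<open>a x\<close> for all \<open>a\<close> in \<open>R\<close> and all
  generators \<open>x\<close> of \<open>M\<close>; so the largest \<open>R\<close>-submodule inside \<open>H\<close>, called \<open>?K\<close> below, is \<open>M\<close>.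
\<close>

lemma (in left_module) restrict_scalars_finitely_generated:
  assumes S: "ring S" and \<phi>: "\<phi> \<in> ring_hom S R"
    and fgR: "finitely_generated S (scalar_module \<phi> R)" and fgM: "finitely_generated R M"
  shows "finitely_generated S (restrict_scalars \<phi> M)"
proof -
  interpret L: left_module R "left_regular R"
    by (rule R.left_regular_left_module)
  interpret SR: left_module S "scalar_module \<phi> R"
    using L.restrict_scalars_left_module[OF S \<phi>] by (simp add: restrict_scalars_left_regular)
  interpret SM: left_module S "restrict_scalars \<phi> M"
    by (rule restrict_scalars_left_module[OF S \<phi>])
  have \<phi>c: "\<phi> r \<in> carrier R" if "r \<in> carrier S" for r
    using \<phi> that by (auto simp: ring_hom_def)
  obtain A where A: "finite A" "A \<subseteq> carrier R"
    "\<forall>H. submodule H S (scalar_module \<phi> R) \<and> A \<subseteq> H \<longrightarrow> H = carrier R"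
    using fgR unfolding SR.finitely_generated_iff by (auto simp: scalar_module_def)
  obtain B where B: "finite B" "B \<subseteq> carrier M" "\<forall>H. submodule H R M \<and> B \<subseteq> H \<longrightarrow> H = carrier M"
    using fgM unfolding finitely_generated_iff by blast
  let ?G = "(\<lambda>(a, x). a \<odot>\<^bsub>M\<^esub> x) ` (A \<times> B)"
  have "H = carrier M" if H: "submodule H S (restrict_scalars \<phi> M)" "?G \<subseteq> H" for H
  proof -
    have h: "H \<subseteq> carrier M" "\<zero>\<^bsub>M\<^esub> \<in> H" "\<And>x y. x \<in> H \<Longrightarrow> y \<in> H \<Longrightarrow> x \<oplus>\<^bsub>M\<^esub> y \<in> H"
      "\<And>r x. r \<in> carrier S \<Longrightarrow> x \<in> H \<Longrightarrow> \<phi> r \<odot>\<^bsub>M\<^esub> x \<in> H"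
      using H(1) unfolding SM.submodule_iff by auto
    have 1: "a \<odot>\<^bsub>M\<^esub> x \<in> H" if a: "a \<in> carrier R" and x: "x \<in> B" for a x
    proof -
      have xc: "x \<in> carrier M" using x B(2) by blast
      let ?I = "{a \<in> carrier R. a \<odot>\<^bsub>M\<^esub> x \<in> H}"
      have "submodule ?I S (scalar_module \<phi> R)"
        unfolding SR.submodule_iff using h xc \<phi>c
        by (auto simp: scalar_module_def smult_l_distr smult_assoc smult_zero_left)
      moreover have "A \<subseteq> ?I" using A(2) x H(2) by auto
      ultimately have "?I = carrier R" using A(3) by blast
      then show ?thesis using a by blast
    qed
    let ?K = "{x \<in> carrier M. \<forall>a\<in>carrier R. a \<odot>\<^bsub>M\<^esub> x \<in> H}"
    have "submodule ?K R M"
      unfolding submodule_iff using h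
      by (auto simp: smult_r_distr smult_zero_right smult_assoc[symmetric])
    moreover have "B \<subseteq> ?K" using B(2) 1 by blast
    ultimately have "?K = carrier M" using B(3) by blast
    then have "\<one> \<odot>\<^bsub>M\<^esub> x \<in> H" if "x \<in> carrier M" for x
      using that by blast
    then show ?thesis using h(1) by auto
  qed
  moreover have "finite ?G" "?G \<subseteq> carrier M"
    using A B by auto
  ultimately show ?thesis
    unfolding SM.finitely_generated_iff by (intro exI[of _ ?G]) simp
qed

lemma (in left_module) surj_endo_inj_module_finite:
  assumes alg: "module_finite_algebra S R \<phi>" and fg: "finitely_generated R M"
    and f: "f \<in> module_hom R M M" and surj: "f ` carrier M = carrier M"
  shows "inj_on f (carrier M)"
proof -
  have S: "cring S" and \<phi>: "\<phi> \<in> ring_hom S R" and fgR: "finitely_generated S (scalar_module \<phi> R)"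
    using alg by (auto simp: module_finite_algebra_def)
  have Sr: "ring S" using S by (rule cring.axioms)
  interpret SM: left_module S "restrict_scalars \<phi> M"
    by (rule restrict_scalars_left_module[OF Sr \<phi>])
  have "f \<in> module_hom S (restrict_scalars \<phi> M) (restrict_scalars \<phi> M)"
    using f \<phi> by (auto simp: module_hom_def ring_hom_def)
  then show ?thesis
    using SM.surj_endo_inj_cring[OF S restrict_scalars_finitely_generated[OF Sr \<phi> fgR fg]] surj
    by simp
qed

section \<open>The three finiteness conditions together\<close>

text \<open>
  Finitely generated modules are Dedekind-finite under each of the three conditions: one-sided
  inverses of endomorphisms are two-sided.
\<close>

lemma (in left_module) right_invertible_endo_surj:
  assumes cond: "left_noetherian_ring R \<or> semilocal_ring R \<or> module_finite_algebra S R \<phi>"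
    and fg: "finitely_generated R M"
    and u: "u \<in> module_hom R M M" and v: "v \<in> module_hom R M M"
    and uv: "\<And>x. x \<in> carrier M \<Longrightarrow> u (v x) = x"
  shows "v ` carrier M = carrier M"
proof (cases "semilocal_ring R")
  case True
  then show ?thesis
    using fg u v uv by (rule right_invertible_endo_semilocal)
next
  case False
  have c: "u x \<in> carrier M" "v x \<in> carrier M" if "x \<in> carrier M" for x
    using that u v by (auto simp: module_hom_def)
  have "u ` carrier M = carrier M"
    using c uv by (metis image_eqI image_subsetI subsetI subset_antisym)
  then have inj: "inj_on u (carrier M)"
    using cond False surj_endo_inj_noetherian[OF _ fg u] surj_endo_inj_module_finite[OF _ fg u]
    by blast
  have "v (u x) = x" if "x \<in> carrier M" for x
    using inj_onD[OF inj] uv c that by simp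
  then show ?thesis
    using c by (metis image_eqI image_subsetI subsetI subset_antisym)
qed

section \<open>Homomorphisms into the bidual\<close>

text \<open>
  Since \<open>M\<^sup>*\<^sup>*\<close> is the dual of \<open>M\<^sup>*\<close>, a homomorphism \<open>g\<close> from \<open>M\<close> to it is the same as a pairing
  \<open>(m, f) \<mapsto> g m f\<close>, and so has a transpose \<open>t\<close> from \<open>M\<^sup>*\<close> to itself with \<open>t f m = g m f\<close>. The
  map \<open>q\<close> is the dual of \<open>t\<close>; evaluation at \<open>m\<close> is sent by it to \<open>f \<mapsto> t f m = g m f\<close>.
\<close>

lemma (in left_module) hom_to_bidual_factors_canonical_map:
  assumes g: "g \<in> module_hom R M (bidual R M)"
  obtains q where "q \<in> module_hom R (bidual R M) (bidual R M)"
    "\<And>m. m \<in> carrier M \<Longrightarrow> q (canonical_map R M m) = g m"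
proof -
  let ?D = "left_dual R M" and ?B = "bidual R M"
  interpret D: right_module R ?D by (rule left_dual_right_module)
  have B: "\<psi> f \<in> carrier R" "\<psi> (f \<oplus>\<^bsub>?D\<^esub> f') = \<psi> f \<oplus> \<psi> f'"
    if "\<psi> \<in> carrier ?B" "f \<in> carrier ?D" "f' \<in> carrier ?D" for \<psi> f f'
    using that by (auto simp: bidual_def right_dual_sel module_hom_def)
  have B_smult: "\<psi> (a \<odot>\<^bsub>?D\<^esub> f) = \<psi> f \<otimes> a"
    if "\<psi> \<in> carrier ?B" "f \<in> carrier ?D" "a \<in> carrier R" for \<psi> f a
    using that by (auto simp: bidual_def right_dual_sel module_hom_def)
  have B_ext: "\<psi> \<in> extensional (carrier ?D)" if "\<psi> \<in> carrier ?B" for \<psi>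
    using that by (auto simp: bidual_def right_dual_sel)
  have B_mem: "(\<lambda>f\<in>carrier ?D. \<psi> f) \<in> carrier ?B"
    if "\<And>f. f \<in> carrier ?D \<Longrightarrow> \<psi> f \<in> carrier R"
      "\<And>f f'. f \<in> carrier ?D \<Longrightarrow> f' \<in> carrier ?D \<Longrightarrow> \<psi> (f \<oplus>\<^bsub>?D\<^esub> f') = \<psi> f \<oplus> \<psi> f'"
      "\<And>f a. f \<in> carrier ?D \<Longrightarrow> a \<in> carrier R \<Longrightarrow> \<psi> (a \<odot>\<^bsub>?D\<^esub> f) = \<psi> f \<otimes> a" for \<psi>
    using that by (auto simp: bidual_def right_dual_sel module_hom_def)
  have gB: "g m \<in> carrier ?B" if "m \<in> carrier M" for m
    using g that by (auto simp: module_hom_def)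
  define t where "t f = (\<lambda>m\<in>carrier M. g m f)" for f
  have g_add: "g (m \<oplus>\<^bsub>M\<^esub> n) f = g m f \<oplus> g n f"
    and g_smult: "g (a \<odot>\<^bsub>M\<^esub> m) f = a \<otimes> g m f"
    if "m \<in> carrier M" "n \<in> carrier M" "a \<in> carrier R" "f \<in> carrier ?D" for m n a f
    using g that by (auto simp: module_hom_def bidual_def right_dual_sel)
  have t: "t f \<in> carrier ?D" if f: "f \<in> carrier ?D" for f
    using g_add[OF _ _ R.zero_closed f] g_smult[OF _ M.zero_closed _ f] B(1)[OF gB f f]
    by (auto simp: t_def left_dual_sel module_hom_def)
  have t_add: "t (f \<oplus>\<^bsub>?D\<^esub> f') = t f \<oplus>\<^bsub>?D\<^esub> t f'" if f: "f \<in> carrier ?D" "f' \<in> carrier ?D" for f f'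
    unfolding left_dual_sel(3)[of R M "t f"] using B(2)[OF gB f]
    by (auto simp: t_def intro!: restrict_ext)
  have t_smult: "t (a \<odot>\<^bsub>?D\<^esub> f) = a \<odot>\<^bsub>?D\<^esub> t f" if f: "f \<in> carrier ?D" "a \<in> carrier R" for f a
    unfolding left_dual_sel(4)[of R M a "t f"] using B_smult[OF gB f]
    by (auto simp: t_def intro!: restrict_ext)
  define q where "q \<psi> = (\<lambda>f\<in>carrier ?D. \<psi> (t f))" for \<psi> :: "('m \<Rightarrow> 'a) \<Rightarrow> 'a"
  have q: "q \<psi> \<in> carrier ?B" if \<psi>: "\<psi> \<in> carrier ?B" for \<psi>
    unfolding q_def using t t_add t_smult B[OF \<psi>] B_smult[OF \<psi>]
    by (intro B_mem) simp_all
  have "q \<in> module_hom R ?B ?B"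
    unfolding module_hom_def using q t
    by (auto simp: q_def bidual_def right_dual_sel intro!: restrict_ext)
  moreover have "q (canonical_map R M m) = g m" if m: "m \<in> carrier M" for m
  proof (rule extensionalityI[of _ "carrier ?D"])
    show "q (canonical_map R M m) \<in> extensional (carrier ?D)" by (simp add: q_def)
    show "g m \<in> extensional (carrier ?D)" by (rule B_ext[OF gB[OF m]])
    show "q (canonical_map R M m) f = g m f" if f: "f \<in> carrier ?D" for f
      using f t[OF f] m by (simp add: q_def canonical_map_def) (simp add: t_def)
  qed
  ultimately show thesis by (rule that)
qed

lemma (in left_module) module_iso_inverse:
  assumes g: "g \<in> module_iso R M N"
  shows "inv_into (carrier M) g \<in> module_hom R N M"
proof -
  let ?i = "inv_into (carrier M) g"
  have bij: "bij_betw g (carrier M) (carrier N)" and hom: "g \<in> module_hom R M N"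
    using g by (auto simp: module_iso_def)
  have ic: "?i y \<in> carrier M" "g (?i y) = y" if "y \<in> carrier N" for y
    using that bij by (auto simp: bij_betw_def inv_into_into f_inv_into_f)
  have ig: "?i (g x) = x" if "x \<in> carrier M" for x
    using that bij by (simp add: bij_betw_def)
  have "?i (x \<oplus>\<^bsub>N\<^esub> y) = ?i x \<oplus>\<^bsub>M\<^esub> ?i y" if "x \<in> carrier N" "y \<in> carrier N" for x y
  proof -
    have "g (?i x \<oplus>\<^bsub>M\<^esub> ?i y) = x \<oplus>\<^bsub>N\<^esub> y"
      using hom ic that by (auto simp: module_hom_def)
    then show ?thesis using ig[of "?i x \<oplus>\<^bsub>M\<^esub> ?i y"] ic that by simp
  qed
  moreover have "?i (a \<odot>\<^bsub>N\<^esub> x) = a \<odot>\<^bsub>M\<^esub> ?i x" if "x \<in> carrier N" "a \<in> carrier R" for x a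
  proof -
    have "g (a \<odot>\<^bsub>M\<^esub> ?i x) = a \<odot>\<^bsub>N\<^esub> x"
      using hom ic that by (auto simp: module_hom_def)
    then show ?thesis using ig[of "a \<odot>\<^bsub>M\<^esub> ?i x"] ic that by simp
  qed
  ultimately show ?thesis
    using ic by (auto simp: module_hom_def)
qed

theorem proposition1:
  fixes \<Lambda> :: "('a, 'b) ring_scheme"
    and M :: "('a, 'm, 'c) module_scheme"
    and R :: "('r, 'd) ring_scheme"
    and \<phi> :: "'r \<Rightarrow> 'a"
  assumes "ring \<Lambda>"
    and "left_module \<Lambda> M"
    and "finitely_generated \<Lambda> M"
    and "left_noetherian_ring \<Lambda> \<or> semilocal_ring \<Lambda> \<or> module_finite_algebra R \<Lambda> \<phi>"
  shows "reflexive_module \<Lambda> M \<longleftrightarrow> (\<exists>f. f \<in> module_iso \<Lambda> M (bidual \<Lambda> M))"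
proof
  assume "reflexive_module \<Lambda> M"
  then show "\<exists>f. f \<in> module_iso \<Lambda> M (bidual \<Lambda> M)"
    unfolding reflexive_module_def by blast
next
  interpret left_module \<Lambda> M by fact
  let ?B = "bidual \<Lambda> M" and ?h = "canonical_map \<Lambda> M"
  assume "\<exists>f. f \<in> module_iso \<Lambda> M ?B"
  then obtain g where iso: "g \<in> module_iso \<Lambda> M ?B" ..
  then have g: "g \<in> module_hom \<Lambda> M ?B" and bij: "bij_betw g (carrier M) (carrier ?B)"
    by (auto simp: module_iso_def)
  define i where "i = inv_into (carrier M) g"
  have i: "i \<in> module_hom \<Lambda> ?B M"
    unfolding i_def by (rule module_iso_inverse[OF iso])
  have ig: "i (g x) = x" if "x \<in> carrier M" for x
    using that bij by (simp add: i_def bij_betw_def)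
  have gi: "g (i y) = y" if "y \<in> carrier ?B" for y
    using that bij by (simp add: i_def bij_betw_def f_inv_into_f)
  obtain q where q: "q \<in> module_hom \<Lambda> ?B ?B"
    and qh: "\<And>m. m \<in> carrier M \<Longrightarrow> q (?h m) = g m"
    using hom_to_bidual_factors_canonical_map[OF g] by blast
  have h: "?h \<in> module_hom \<Lambda> M ?B"
    by (rule canonical_map_hom)
  have hc: "?h m \<in> carrier ?B" if "m \<in> carrier M" for m
    using h that by (auto simp: module_hom_def)
  \<comment> \<open>Transported to \<open>M\<close> along \<open>g\<close>, the factorisation \<open>q \<circ> ?h = g\<close> exhibits a right
    invertible endomorphism of \<open>M\<close>.\<close>
  have "(i \<circ> q \<circ> g) ((i \<circ> ?h) m) = m" if m: "m \<in> carrier M" for m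
    using gi[OF hc[OF m]] qh[OF m] ig[OF m] by simp
  then have surj: "(i \<circ> ?h) ` carrier M = carrier M"
    using module_hom_comp[OF g module_hom_comp[OF q i]] module_hom_comp[OF h i]
    by (intro right_invertible_endo_surj[OF assms(4,3), of "i \<circ> q \<circ> g"]) (simp_all add: comp_assoc)
  have "inj_on ?h (carrier M)"
    using qh ig by (intro inj_on_inverseI[of _ "i \<circ> q"]) simp
  moreover have "?h ` carrier M = carrier ?B"
  proof -
    have "?h ` carrier M = g ` (i \<circ> ?h) ` carrier M"
      using gi hc by (force simp: image_image)
    also have "\<dots> = carrier ?B"
      unfolding surj using bij by (simp add: bij_betw_def)
    finally show ?thesis .
  qed
  ultimately show "reflexive_module \<Lambda> M"
    using h by (simp add: reflexive_module_def module_iso_def bij_betw_def)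
qed

end
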